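(* There exists an absolute constant $c>0$ such that the following holds. Let $1\le n\leq N$ be integers. There exists an $n$-dimensional convex symmetric body $B$ such that for every $n$-dimensional convex body $K$ obtained as a projection of a section of an $N$-dimensional simplex one has $$ d(B, K) \geq c \sqrt{ \frac{ n }{ \ln \frac{2 N \ln (2N)}{n} }} .$$
   Context: A convex body is a compact convex set with non-empty interior (in $\mathbb{R}^n$, or in an $n$-dimensional affine subspace identified with $\mathbb{R}^n$); symmetric means $B=-B$. For two convex bodies $K_1,K_2\subset\mathbb{R}^n$ the Banach-Mazur distance is $$d(K_1,K_2)=\inf\{\lambda>0 \mid K_1-a\subset T(K_2-b)\subset\lambda(K_1-a)\},$$ where the infimum is over all non-degenerate linear operators $T:\mathbb{R}^n\to\mathbb{R}^n$ and all $a,b\in\mathbb{R}^n$. An $N$-dimensional simplex is (up to affine equivalence) $\Delta_N=\mathrm{conv}\{e_i\}_{i=1}^{N+1}\subset\mathbb{R}^{N+1}$, with $e_1,\dots,e_{N+1}$ the standard basis. A section of $\Delta_N$ is a set $\Delta_N\cap F$ with $F\subset\mathbb{R}^{N+1}$ an affine subspace of arbitrary dimension; a projection of a section is the image $P(\Delta_N\cap F)$, where $P$ is the orthogonal projection onto a linear subspace of $\mathbb{R}^{N+1}$. It is regarded as an $n$-dimensional convex body when its affine hull has dimension $n$. "Absolute constant" means independent of $n$, $N$, and all other objects. *)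

theory Defs
  imports "HOL-Analysis.Analysis" "HOL-Analysis.Finite_Function_Topology"
begin

text \<open>
  Since the dimensions \<open>n\<close> and \<open>N\<close> are quantified inside the theorem, \<open>\<real>\<^sup>d\<close> is rendered as a
  subspace of the real normed vector space of finitely supported sequences. The library norm on
  that type is the \<open>\<ell>\<^sub>1\<close> norm, which on each \<open>Rn d\<close> induces the Euclidean topology. The Euclidean
  inner product, needed for orthogonal projections, is \<open>ip\<close>.
\<close>

type_synonym fvec = "nat \<Rightarrow>\<^sub>0 real"

definition Rn :: "nat \<Rightarrow> fvec set"
  where "Rn d = {x. Poly_Mapping.keys x \<subseteq> {..<d}}"

definition ip :: "fvec \<Rightarrow> fvec \<Rightarrow> real"
  where "ip x y = (\<Sum>i\<in>Poly_Mapping.keys x. Poly_Mapping.lookup x i * Poly_Mapping.lookup y i)"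

text \<open>The interior has to be taken relative to \<open>Rn d\<close>: in the ambient type it is always empty.\<close>

definition convex_body :: "nat \<Rightarrow> fvec set \<Rightarrow> bool"
  where "convex_body d K \<longleftrightarrow>
    K \<subseteq> Rn d \<and> convex K \<and> compact K \<and> top_of_set (Rn d) interior_of K \<noteq> {}"

definition symmetric :: "fvec set \<Rightarrow> bool"
  where "symmetric B \<longleftrightarrow> B = uminus ` B"

text \<open>
  A linear operator on \<open>Rn d\<close> is given by a linear map \<open>T\<close> of the ambient type; only its restriction
  to \<open>Rn d\<close> matters, and every linear operator on \<open>Rn d\<close> has such an extension.
\<close>

definition banach_mazur :: "nat \<Rightarrow> fvec set \<Rightarrow> fvec set \<Rightarrow> real"
  where "banach_mazur d K1 K2 = Inf {l. 0 < l \<and>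
    (\<exists>T a b. linear T \<and> bij_betw T (Rn d) (Rn d) \<and> a \<in> Rn d \<and> b \<in> Rn d \<and>
       (\<lambda>x. x - a) ` K1 \<subseteq> T ` (\<lambda>x. x - b) ` K2 \<and>
       T ` (\<lambda>x. x - b) ` K2 \<subseteq> (\<lambda>x. l *\<^sub>R x) ` (\<lambda>x. x - a) ` K1)}"

definition std_simplex :: "nat \<Rightarrow> fvec set"
  where "std_simplex N = convex hull ((\<lambda>i. Poly_Mapping.single i 1) ` {..<N + 1})"

definition orth_proj :: "fvec set \<Rightarrow> fvec \<Rightarrow> fvec"
  where "orth_proj E x = (THE y. y \<in> E \<and> (\<forall>z\<in>E. ip (x - y) z = 0))"

definition proj_of_section_of_simplex :: "nat \<Rightarrow> fvec set \<Rightarrow> bool"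
  where "proj_of_section_of_simplex N S \<longleftrightarrow>
    (\<exists>F E. affine F \<and> F \<subseteq> Rn (N + 1) \<and> subspace E \<and> E \<subseteq> Rn (N + 1) \<and>
       S = orth_proj E ` (std_simplex N \<inter> F))"

text \<open>
  An identification of an affine subspace \<open>A\<close> with \<open>Rn d\<close>; one exists iff \<open>A\<close> is \<open>d\<close>-dimensional.
\<close>

definition affine_identification :: "nat \<Rightarrow> fvec set \<Rightarrow> (fvec \<Rightarrow> fvec) \<Rightarrow> bool"
  where "affine_identification d A \<phi> \<longleftrightarrow>
    bij_betw \<phi> A (Rn d) \<and> (\<exists>L v. linear L \<and> (\<forall>x\<in>A. \<phi> x = L x + v))"

text \<open>
  \<open>K \<subseteq> Rn n\<close> is a projection of a section of the \<open>N\<close>-simplex with affine hull of dimension \<open>n\<close>,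
  regarded as a body in \<open>\<real>\<^sup>n\<close>. All identifications are admitted; the Banach-Mazur distance does not
  depend on the choice.
\<close>

definition body_from_simplex :: "nat \<Rightarrow> nat \<Rightarrow> fvec set \<Rightarrow> bool"
  where "body_from_simplex n N K \<longleftrightarrow> convex_body n K \<and>
    (\<exists>S \<phi>. proj_of_section_of_simplex N S \<and> affine_identification n (affine hull S) \<phi> \<and> K = \<phi> ` S)"

end

theory Submission
  imports Defs
begin

text \<open>
  The body is \<open>B = conv V\<close>, where \<open>V\<close> consists of \<open>M\<close> sign vectors, their negatives and the
  vectors \<open>\<plusminus>e\<^sub>i\<close>; a counting argument yields a good choice of the sign vectors. Suppose
  \<open>B \<subseteq> K \<subseteq> \<rho> B\<close> with \<open>K\<close> a projection of a section of the simplex. Lift each vertex of \<open>B\<close> to the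
  section, scale every barycentric coordinate to have maximum \<open>1\<close> over the lifts, and round it to a
  multiple of \<open>1 / P\<close>. By pigeonhole, a maximal set of lifts with pairwise distinct subset sums has
  only \<open>O(N ln N)\<close> elements, and by maximality all rounded lifts are combinations of its elements
  with coefficients in \<open>{-1, 0, 1}\<close>. So \<open>exp(O(N\<^sup>2 ln\<^sup>2 N))\<close> codes suffice. Conversely, every sign
  vector that decodes from the code of \<open>V\<close> lies in \<open>(2 \<rho> + 1) B\<close>, and Maurey's empirical method
  shows that this body contains at most \<open>2\<^bsup>n/2\<^esup>\<close> sign vectors unless \<open>\<rho>\<close> is large. Each code
  therefore serves at most \<open>2\<^bsup>nM/2\<^esup>\<close> of the \<open>2\<^bsup>nM\<^esup>\<close> families, which is not enough once \<open>M\<close> is of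
  order \<open>N\<^sup>2 ln\<^sup>2 N / n\<close>.
\<close>

section \<open>The Euclidean inner product and orthogonal projections\<close>

abbreviation lk where "lk \<equiv> Poly_Mapping.lookup"

lemma lookup_scaleR [simp]: "lk (r *\<^sub>R x) i = r * lk (x :: fvec) i"
  by (simp add: scaleR_poly_mapping_def)

text \<open>\<open>ip\<close> sums over the support of its first argument only. This and the
  companion \<open>ip_eq_sum_right\<close> free the index set, which yields symmetry and
  bilinearity.\<close>

lemma ip_eq_sum_left:
  assumes "finite A" "Poly_Mapping.keys x \<subseteq> A"
  shows "ip x y = (\<Sum>i\<in>A. lk x i * lk y i)"
  unfolding ip_def using assms
  by (intro sum.mono_neutral_left) (auto simp: in_keys_iff)

lemma ip_eq_sum_right:
  assumes "finite A" "Poly_Mapping.keys y \<subseteq> A"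
  shows "ip x y = (\<Sum>i\<in>A. lk x i * lk y i)"
proof -
  have "ip x y = (\<Sum>i\<in>A \<union> Poly_Mapping.keys x. lk x i * lk y i)"
    using assms by (intro ip_eq_sum_left) auto
  also have "\<dots> = (\<Sum>i\<in>A. lk x i * lk y i)"
    using assms by (intro sum.mono_neutral_right) (auto simp: in_keys_iff)
  finally show ?thesis .
qed

lemma ip_commute: "ip x y = ip y x"
  by (simp add: ip_eq_sum_left[of "Poly_Mapping.keys x" x y] ip_eq_sum_right[of "Poly_Mapping.keys x" x y] mult.commute)

lemma ip_add_left: "ip (x + y) z = ip x z + ip y z"
  by (simp add: ip_eq_sum_right[of "Poly_Mapping.keys z"] lookup_add algebra_simps sum.distrib)

lemma ip_scaleR_left: "ip (r *\<^sub>R x) z = r * ip x z"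
  by (simp add: ip_eq_sum_right[of "Poly_Mapping.keys z"] sum_distrib_left mult.assoc)

lemma ip_add_right: "ip z (x + y) = ip z x + ip z y"
  by (metis ip_add_left ip_commute)

lemma ip_scaleR_right: "ip z (r *\<^sub>R x) = r * ip z x"
  by (metis ip_scaleR_left ip_commute)

lemma linear_ip_left: "linear (\<lambda>x. ip x z)"
  by (rule linearI) (simp_all add: ip_add_left ip_scaleR_left)

lemma linear_ip_right: "linear (ip z)"
  by (rule linearI) (simp_all add: ip_add_right ip_scaleR_right)

lemmas ip_diff_left = linear_diff[OF linear_ip_left]
lemmas ip_diff_right = linear_diff[OF linear_ip_right]
lemmas ip_sum_right = linear_sum[OF linear_ip_right]
lemmas ip_zero_right = linear_0[OF linear_ip_right]
lemmas ip_zero_left = linear_0[OF linear_ip_left]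

lemmas ip_simps = ip_add_left ip_add_right ip_diff_left ip_diff_right ip_scaleR_left ip_scaleR_right

lemma ip_nonneg: "0 \<le> ip x x"
  by (simp add: ip_def sum_nonneg)

lemma ip_self_eq_0_iff: "ip x x = 0 \<longleftrightarrow> x = 0"
proof
  assume "ip x x = 0"
  then have "\<forall>i\<in>Poly_Mapping.keys x. lk x i * lk x i = 0"
    unfolding ip_def by (subst (asm) sum_nonneg_eq_0_iff) auto
  then show "x = 0"
    by (metis in_keys_iff lookup_zero mult_eq_0_iff poly_mapping_eqI)
qed (simp add: ip_def)

section \<open>Coordinate subspaces and their orthogonal projections\<close>

lemma Rn_iff: "x \<in> Rn d \<longleftrightarrow> (\<forall>i\<ge>d. lk x i = 0)"
  unfolding Rn_def by (auto simp: in_keys_iff not_le subset_iff)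

lemma subspace_Rn: "subspace (Rn d)"
  unfolding subspace_def by (simp add: Rn_iff lookup_add)

lemma lookup_single_1: "lk (Poly_Mapping.single i c) j = (if i = j then c else (0::real))"
  by (simp add: lookup_single when_def)

lemma Rn_expansion:
  assumes "x \<in> Rn d"
  shows "x = (\<Sum>i<d. lk x i *\<^sub>R Poly_Mapping.single i 1)"
proof (rule poly_mapping_eqI)
  fix j
  have "(\<Sum>i<d. lk x i * (if i = j then 1 else 0)) = (if j < d then lk x j else 0)"
    by (simp add: if_distrib[of "\<lambda>t. _ * t"] cong: if_cong)
  then show "lk x j = lk (\<Sum>i<d. lk x i *\<^sub>R Poly_Mapping.single i 1) j"
    using assms by (auto simp: lookup_sum lookup_single_1 Rn_iff)
qed

lemma subspace_eq_span_finite: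
  assumes "subspace E" "E \<subseteq> Rn d"
  obtains S where "finite S" "E = span S"
proof -
  let ?U = "(\<lambda>i. Poly_Mapping.single i (1::real)) ` {..<d}"
  have "E \<subseteq> span ?U"
  proof
    fix x assume "x \<in> E"
    then have "x = (\<Sum>i<d. lk x i *\<^sub>R Poly_Mapping.single i 1)"
      using assms(2) Rn_expansion by blast
    also have "\<dots> \<in> span ?U"
      by (intro span_sum span_scale span_base) auto
    finally show "x \<in> span ?U" .
  qed
  moreover obtain S where S: "S \<subseteq> E" "independent S" "E \<subseteq> span S"
    using maximal_independent_subset by blast
  ultimately have "finite S"
    using independent_span_bound[of ?U S] by auto
  moreover have "E = span S"
    using S assms(1) by (meson span_minimal subset_antisym)
  ultimately show ?thesis using that by blast
qed

text \<open>One Gram-Schmidt step: \<open>a - p\<close> is the part of \<open>a\<close> orthogonal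
  to \<open>span S\<close>, and correcting \<open>y\<close> along it handles the enlarged
  span.\<close>

lemma projection_exists_span:
  assumes "finite S"
  shows "\<exists>y\<in>span S. \<forall>z\<in>span S. ip (x - y) z = 0"
  using assms
proof (induction S arbitrary: x rule: finite_induct)
  case empty
  then show ?case by (simp add: ip_zero_right)
next
  case (insert a S)
  obtain p where p: "p \<in> span S" "\<And>z. z \<in> span S \<Longrightarrow> ip (a - p) z = 0"
    using insert.IH by blast
  obtain y where y: "y \<in> span S" "\<And>z. z \<in> span S \<Longrightarrow> ip (x - y) z = 0"
    using insert.IH by blast
  \<comment> \<open>If \<open>a = p\<close>, division by zero gives \<open>r = 0\<close>, which is
    right because \<open>a\<close> already lies in \<open>span S\<close>.\<close>
  define r where "r = ip (x - y) a / ip (a - p) (a - p)"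
  have aa: "ip (a - p) (a - p) = ip (a - p) a"
    using p by (simp add: ip_diff_right[of _ a p])
  have "ip (x - y) a = r * ip (a - p) a"
  proof (cases "a = p")
    case True
    then show ?thesis using y(2)[OF p(1)] by (simp add: ip_zero_left)
  next
    case False
    then have "ip (a - p) (a - p) \<noteq> 0" by (simp add: ip_self_eq_0_iff)
    then show ?thesis unfolding r_def aa[symmetric] by simp
  qed
  then have *: "ip (x - y - r *\<^sub>R (a - p)) a = 0"
    by (simp add: ip_diff_left[of "x - y"] ip_scaleR_left)
  have "ip (x - (y + r *\<^sub>R (a - p))) z = 0" if z: "z \<in> span (insert a S)" for z
  proof -
    obtain t where t: "z - t *\<^sub>R a \<in> span S"
      using z unfolding span_insert by auto
    have "ip (x - y - r *\<^sub>R (a - p)) (z - t *\<^sub>R a) = 0"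
      using y(2)[OF t] p(2)[OF t] by (simp add: ip_diff_left[of "x - y"] ip_scaleR_left)
    then have "ip (x - y - r *\<^sub>R (a - p)) z = 0"
      using * by (simp add: ip_diff_right[of _ z] ip_scaleR_right)
    then show ?thesis by (simp add: diff_diff_eq)
  qed
  moreover have "y + r *\<^sub>R (a - p) \<in> span (insert a S)"
    using y(1) p(1) span_mono[of S "insert a S"]
    by (intro span_add span_scale span_diff) (auto intro: span_base)
  ultimately show ?case by blast
qed

text \<open>Two candidates differ by a vector of \<open>E\<close> that is orthogonal to itself, so
  the description in \<open>orth_proj\<close> has at most one solution.\<close>

lemma orth_proj_eqI:
  assumes "subspace E" "y \<in> E" "\<And>z. z \<in> E \<Longrightarrow> ip (x - y) z = 0"
  shows "orth_proj E x = y"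
  unfolding orth_proj_def
proof (rule the_equality)
  show "y \<in> E \<and> (\<forall>z\<in>E. ip (x - y) z = 0)" using assms by blast
next
  fix w assume w: "w \<in> E \<and> (\<forall>z\<in>E. ip (x - w) z = 0)"
  then have d: "y - w \<in> E" using assms by (simp add: subspace_diff)
  have "ip (y - w) (y - w) = ip (x - w) (y - w) - ip (x - y) (y - w)"
    by (simp add: ip_diff_left[symmetric])
  also have "\<dots> = 0" using w d assms(3) by simp
  finally show "w = y" by (simp add: ip_self_eq_0_iff)
qed

lemma orth_proj_props:
  assumes "subspace E" "E \<subseteq> Rn d"
  shows "orth_proj E x \<in> E" "z \<in> E \<Longrightarrow> ip (x - orth_proj E x) z = 0"
proof -
  obtain y where "y \<in> E" "\<forall>z\<in>E. ip (x - y) z = 0"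
    using subspace_eq_span_finite[OF assms] projection_exists_span by metis
  with orth_proj_eqI[OF assms(1)]
  show "orth_proj E x \<in> E" "z \<in> E \<Longrightarrow> ip (x - orth_proj E x) z = 0" by metis+
qed

lemma linear_orth_proj:
  assumes "subspace E" "E \<subseteq> Rn d"
  shows "linear (orth_proj E)"
proof (rule linearI)
  fix x y :: fvec and r :: real
  show "orth_proj E (x + y) = orth_proj E x + orth_proj E y"
  proof (rule orth_proj_eqI[OF assms(1)])
    show "orth_proj E x + orth_proj E y \<in> E"
      using orth_proj_props[OF assms] assms(1) by (simp add: subspace_add)
    fix z assume "z \<in> E"
    then show "ip (x + y - (orth_proj E x + orth_proj E y)) z = 0"
      using orth_proj_props(2)[OF assms, of z x] orth_proj_props(2)[OF assms, of z y]
      by (simp add: ip_simps)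
  qed
  show "orth_proj E (r *\<^sub>R x) = r *\<^sub>R orth_proj E x"
  proof (rule orth_proj_eqI[OF assms(1)])
    show "r *\<^sub>R orth_proj E x \<in> E"
      using orth_proj_props[OF assms] assms(1) by (simp add: subspace_scale)
    fix z assume "z \<in> E"
    then show "ip (r *\<^sub>R x - r *\<^sub>R orth_proj E x) z = 0"
      using orth_proj_props(2)[OF assms, of z x]
      by (simp add: ip_simps)
  qed
qed

text \<open>Coordinates in \<open>Rn (N + 1)\<close> are barycentric coordinates. Inside an affine
  combination of points of the simplex only their nonnegativity remains to be checked.\<close>

lemma std_simplex_iff:
  "x \<in> std_simplex N \<longleftrightarrow> x \<in> Rn (N + 1) \<and> (\<forall>i\<le>N. 0 \<le> lk x i) \<and> (\<Sum>i\<le>N. lk x i) = 1"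
proof -
  let ?e = "\<lambda>i. Poly_Mapping.single i (1::real)"
  let ?D = "{x \<in> Rn (N + 1). (\<forall>i\<le>N. 0 \<le> lk x i) \<and> (\<Sum>i\<le>N. lk x i) = 1}"
  have "std_simplex N \<subseteq> ?D"
    unfolding std_simplex_def
  proof (rule hull_minimal)
    show "?e ` {..<N + 1} \<subseteq> ?D"
      by (auto simp: Rn_iff lookup_single_1 cong: if_cong)
    show "convex ?D"
      unfolding convex_def
      by (auto simp: Rn_iff lookup_add sum.distrib simp flip: sum_distrib_left)
  qed
  moreover have "x \<in> std_simplex N" if x: "x \<in> ?D" for x
  proof -
    have "(\<Sum>i<N + 1. lk x i *\<^sub>R ?e i) \<in> std_simplex N"
      unfolding std_simplex_def using x
      by (intro convex_sum convex_convex_hull)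
         (auto intro: hull_inc simp flip: lessThan_Suc_atMost)
    then show ?thesis using x Rn_expansion[of x "N + 1"] by simp
  qed
  ultimately show ?thesis by auto
qed

section \<open>Dissociated sets and counting bounds\<close>

text \<open>Take \<open>S\<close> of maximal size with pairwise distinct subset sums. The
  \<open>2 ^ card S\<close> sums lie in a box of integer points, which bounds \<open>card S\<close>.
  Adding a further \<open>v\<close> creates a coincidence of two subset sums, which expresses
  \<open>g v\<close>.\<close>

lemma dissociated_spanning_subset:
  fixes g :: "'v \<Rightarrow> 'i \<Rightarrow> int"
  assumes V: "finite V" and I: "finite I"
    and bd: "\<And>v i. v \<in> V \<Longrightarrow> i \<in> I \<Longrightarrow> \<bar>g v i\<bar> \<le> int P"
  obtains S where "S \<subseteq> V"
    "inj_on (\<lambda>A. restrict (\<lambda>i. \<Sum>v\<in>A. g v i) I) (Pow S)"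
    "2 ^ card S \<le> (2 * P * card S + 1) ^ card I"
    "\<And>v. v \<in> V \<Longrightarrow> \<exists>A A'. A \<subseteq> S \<and> A' \<subseteq> S \<and> (\<forall>i\<in>I. g v i = (\<Sum>w\<in>A. g w i) - (\<Sum>w\<in>A'. g w i))"
proof -
  define s where "s A = restrict (\<lambda>i. \<Sum>v\<in>A. g v i) I" for A
  define Q where "Q S \<longleftrightarrow> S \<subseteq> V \<and> inj_on s (Pow S)" for S
  have "Q {}" by (simp add: Q_def)
  moreover have "\<forall>S. Q S \<longrightarrow> card S < Suc (card V)"
    using V by (simp add: Q_def card_mono less_Suc_eq_le)
  ultimately have "\<exists>S. Q S \<and> (\<forall>S'. Q S' \<longrightarrow> card S' \<le> card S)"
    by (rule ex_has_greatest_nat)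
  then obtain S where S: "Q S" and mx: "\<And>S'. Q S' \<Longrightarrow> card S' \<le> card S"
    by auto
  have SV: "S \<subseteq> V" and inj: "inj_on s (Pow S)" using S by (auto simp: Q_def)
  have fS: "finite S" using SV V finite_subset by blast
  show ?thesis
  proof (rule that[OF SV])
    show "inj_on (\<lambda>A. restrict (\<lambda>i. \<Sum>v\<in>A. g v i) I) (Pow S)"
      using inj by (simp add: s_def[abs_def])
  next
    let ?b = "int (P * card S)"
    have "s A \<in> I \<rightarrow>\<^sub>E {- ?b..?b}" if A: "A \<subseteq> S" for A
    proof -
      have "\<bar>\<Sum>v\<in>A. g v i\<bar> \<le> ?b" if i: "i \<in> I" for i
      proof -
        have "\<bar>\<Sum>v\<in>A. g v i\<bar> \<le> (\<Sum>v\<in>A. \<bar>g v i\<bar>)" by (rule sum_abs)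
        also have "\<dots> \<le> (\<Sum>v\<in>A. int P)"
          using A SV bd i by (intro sum_mono) auto
        also have "\<dots> \<le> ?b"
          using card_mono[OF fS A] by (simp add: mult.commute mult_left_mono flip: of_nat_mult)
        finally show ?thesis .
      qed
      then show ?thesis by (auto simp: s_def abs_le_iff minus_le_iff)
    qed
    then have "card (s ` Pow S) \<le> card (I \<rightarrow>\<^sub>E {- ?b..?b})"
      using I by (intro card_mono finite_PiE) auto
    also have "\<dots> = (2 * P * card S + 1) ^ card I"
      using I by (simp add: card_PiE nat_add_distrib nat_mult_distrib mult.assoc)
    finally show "2 ^ card S \<le> (2 * P * card S + 1) ^ card I"
      using inj fS by (simp add: card_image card_Pow)
  next
    fix v assume v: "v \<in> V"
    show "\<exists>A A'. A \<subseteq> S \<and> A' \<subseteq> S \<and> (\<forall>i\<in>I. g v i = (\<Sum>w\<in>A. g w i) - (\<Sum>w\<in>A'. g w i))"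
    proof (cases "v \<in> S")
      case True
      then have "{v} \<subseteq> S" "{} \<subseteq> S" "\<forall>i\<in>I. g v i = (\<Sum>w\<in>{v}. g w i) - (\<Sum>w\<in>{}. g w i)"
        by auto
      then show ?thesis by blast
    next
      case False
      then have "\<not> Q (insert v S)" using mx[of "insert v S"] fS by auto
      then have "\<not> inj_on s (Pow (insert v S))" using v SV by (auto simp: Q_def)
      then obtain X Y where XY: "X \<subseteq> insert v S" "Y \<subseteq> insert v S" "s X = s Y" "X \<noteq> Y"
        unfolding inj_on_def by blast
      have fin: "finite X" "finite Y" using XY fS finite_subset by blast+
      have eq: "(\<Sum>w\<in>X. g w i) = (\<Sum>w\<in>Y. g w i)" if "i \<in> I" for i
        using fun_cong[OF XY(3), of i] that by (simp add: s_def)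
      \<comment> \<open>A coincidence with \<open>v\<close> on one side only can be solved for
        \<open>g v\<close>.\<close>
      have one: ?thesis if "X' \<subseteq> insert v S" "Y' \<subseteq> insert v S" "v \<in> X'" "v \<notin> Y'"
        and eqs: "\<And>i. i \<in> I \<Longrightarrow> (\<Sum>w\<in>X'. g w i) = (\<Sum>w\<in>Y'. g w i)" for X' Y'
      proof -
        have "g v i = (\<Sum>w\<in>Y'. g w i) - (\<Sum>w\<in>X' - {v}. g w i)" if i: "i \<in> I" for i
        proof -
          have "finite X'" using \<open>X' \<subseteq> insert v S\<close> fS finite_subset by blast
          then have "(\<Sum>w\<in>X'. g w i) = g v i + (\<Sum>w\<in>X' - {v}. g w i)"
            using \<open>v \<in> X'\<close> by (rule sum.remove)
          then show ?thesis
            using eqs[OF i] by simp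
        qed
        moreover have "Y' \<subseteq> S" "X' - {v} \<subseteq> S" using that by auto
        ultimately show ?thesis by blast
      qed
      consider "v \<in> X" "v \<notin> Y" | "v \<in> Y" "v \<notin> X" | "v \<in> X" "v \<in> Y" | "v \<notin> X" "v \<notin> Y"
        by blast
      then show ?thesis
      proof cases
        case 1 then show ?thesis using one[of X Y] XY eq by auto
      next
        case 2 then show ?thesis using one[of Y X] XY eq by auto
      next
        \<comment> \<open>Deleting \<open>v\<close> from both sides leaves a coincidence inside
          \<open>S\<close>, where subset sums are distinct.\<close>
        case 3
        have "s (X - {v}) = s (Y - {v})"
          unfolding s_def
        proof (rule restrict_ext)
          fix i assume "i \<in> I"
          then show "(\<Sum>w\<in>X - {v}. g w i) = (\<Sum>w\<in>Y - {v}. g w i)"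
            using eq[of i] sum.remove[OF fin(1) 3(1), of "\<lambda>w. g w i"]
              sum.remove[OF fin(2) 3(2), of "\<lambda>w. g w i"] by simp
        qed
        then have "X - {v} = Y - {v}"
          using inj_onD[OF inj] XY by auto
        then have "X = Y" using 3 by auto
        then show ?thesis using XY by simp
      next
        case 4
        then show ?thesis using inj_onD[OF inj XY(3)] XY by blast
      qed
    qed
  qed
qed

text \<open>A set of at most \<open>k\<close> elements is listed by a word of length
  \<open>k\<close> over \<open>U\<close> with \<open>None\<close> as padding.\<close>

lemma card_small_subsets_le:
  assumes "finite U"
  shows "card {C. C \<subseteq> U \<and> card C \<le> k} \<le> (card U + 1) ^ k"
proof -
  let ?F = "{..<k} \<rightarrow>\<^sub>E insert None (Some ` U)"
  have "{C. C \<subseteq> U \<and> card C \<le> k} \<subseteq> (\<lambda>f. {u. Some u \<in> f ` {..<k}}) ` ?F"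
  proof
    fix C assume "C \<in> {C. C \<subseteq> U \<and> card C \<le> k}"
    then have C: "C \<subseteq> U" "card C \<le> k" by auto
    then have "finite C" using assms finite_subset by blast
    then obtain h where h: "bij_betw h {0..<card C} C" using ex_bij_betw_nat_finite by blast
    define f where "f = restrict (\<lambda>i. if i < card C then Some (h i) else None) {..<k}"
    have h2: "h ` {0..<card C} = C" using h by (simp add: bij_betw_def)
    have "h i \<in> U" if "i < card C" for i using h2 C that by auto
    then have "f \<in> ?F" by (auto simp: f_def)
    moreover have "C = {u. Some u \<in> f ` {..<k}}"
    proof (intro set_eqI iffI)
      fix u assume "u \<in> C"
      then obtain i where i: "i < card C" "u = h i" using h2 by (metis atLeastLessThan_iff imageE)
      then have "f i = Some u" "i < k" using C by (auto simp: f_def)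
      then show "u \<in> {u. Some u \<in> f ` {..<k}}" by force
    next
      fix u assume "u \<in> {u. Some u \<in> f ` {..<k}}"
      then show "u \<in> C" using h2 by (auto simp: f_def split: if_splits)
    qed
    ultimately show "C \<in> (\<lambda>f. {u. Some u \<in> f ` {..<k}}) ` ?F" by (intro rev_image_eqI[of f])
  qed
  then have "card {C. C \<subseteq> U \<and> card C \<le> k} \<le> card ?F"
    using assms by (intro surj_card_le[rotated] finite_PiE) simp_all
  also have "\<dots> = (card U + 1) ^ k"
    using assms by (simp add: card_PiE card_insert_if card_image)
  finally show ?thesis .
qed

text \<open>Generating function bound: giving each \<open>c\<close> the weight
  \<open>z ^ sum c V\<close> turns the total over the box \<open>?D\<close> into a product of
  geometric sums, at most \<open>(1 / (1 - z)) ^ card V\<close>.\<close>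

lemma card_weak_compositions_le:
  assumes "finite V" "k \<ge> 1" "V \<noteq> {}"
  shows "finite {c \<in> V \<rightarrow>\<^sub>E UNIV. sum c V = (k::nat)}" (is "finite ?C")
    "real (card {c \<in> V \<rightarrow>\<^sub>E UNIV. sum c V = k}) \<le> (exp 1 * (card V + k) / k) ^ k"
proof -
  let ?D = "V \<rightarrow>\<^sub>E {..k}"
  have sub: "?C \<subseteq> ?D"
  proof
    fix c assume c: "c \<in> ?C"
    then have "c v \<le> k" if "v \<in> V" for v
      using member_le_sum[of v V c] assms(1) that by auto
    then show "c \<in> ?D" using c by (auto simp: PiE_iff)
  qed
  have fD: "finite ?D" using assms by (simp add: finite_PiE)
  then show fin: "finite ?C" using sub finite_subset by blast
  \<comment> \<open>This \<open>z\<close> minimises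
    \<open>(1 / (1 - z)) ^ m / z ^ k\<close>.\<close>
  define m z where "m = card V" and "z = real k / (m + k)"
  have m: "m > 0" using assms by (auto simp: m_def card_gt_0_iff)
  have z: "0 < z" "z < 1" "1 - z = m / (m + k)" using assms m by (auto simp: z_def field_simps)
  have "real (card ?C) * z ^ k = (\<Sum>c\<in>?C. \<Prod>v\<in>V. z ^ c v)"
    by (simp add: power_sum[symmetric])
  also have "\<dots> \<le> (\<Sum>c\<in>?D. \<Prod>v\<in>V. z ^ c v)"
    using z by (intro sum_mono2[OF fD sub] prod_nonneg) auto
  also have "\<dots> = (\<Prod>v\<in>V. \<Sum>j\<le>k. z ^ j)"
    using assms by (subst prod_sum_PiE) auto
  also have "\<dots> = (\<Sum>j\<le>k. z ^ j) ^ m" by (simp add: m_def)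
  also have "\<dots> \<le> (1 / (1 - z)) ^ m"
  proof (rule power_mono)
    have "(\<Sum>j\<le>k. z ^ j) = (1 - z ^ Suc k) / (1 - z)"
      using z by (simp add: sum_gp0)
    also have "\<dots> \<le> 1 / (1 - z)"
      using z by (intro divide_right_mono) auto
    finally show "(\<Sum>j\<le>k. z ^ j) \<le> 1 / (1 - z)" .
  qed (use z in \<open>auto intro: sum_nonneg\<close>)
  also have "1 / (1 - z) = 1 + k / m" using m z by (simp add: field_simps)
  also have "(1 + k / m) ^ m \<le> exp (k / m) ^ m"
    by (intro power_mono exp_ge_add_one_self) auto
  also have "\<dots> = exp 1 ^ k" using m by (simp add: exp_of_nat_mult[symmetric])
  finally have "real (card ?C) \<le> exp 1 ^ k / z ^ k"
    using z by (simp add: field_simps)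
  also have "\<dots> = (exp 1 * (m + k) / k) ^ k"
    by (simp add: z_def power_divide power_mult_distrib)
  finally show "real (card ?C) \<le> (exp 1 * (card V + k) / k) ^ k" by (simp add: m_def)
qed

text \<open>Chernoff-type bound with weight \<open>(1 / 16) ^ d\<close> at Hamming distance
  \<open>d\<close>: the weight is at least \<open>2 powr (- n / 16)\<close> on the ball, and the
  total over the cube is \<open>(17 / 16) ^ n\<close>, at most
  \<open>2 powr (n / 8)\<close>.\<close>

lemma card_hamming_ball_le:
  assumes "A0 \<subseteq> {..<n}"
  shows "real (card {A. A \<subseteq> {..<n} \<and> 64 * card (sym_diff A A0) \<le> n}) \<le> 2 powr (3 * real n / 16)"
proof -
  let ?H = "{A. A \<subseteq> {..<n} \<and> 64 * card (sym_diff A A0) \<le> n}"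
  let ?t = "(1/16 :: real)"
  have bij: "bij_betw (\<lambda>A. sym_diff A A0) (Pow {..<n}) (Pow {..<n})"
    using assms by (intro bij_betwI[of _ _ _ "\<lambda>A. sym_diff A A0"]) auto
  have sub: "?H \<subseteq> Pow {..<n}" by auto
  have "real (card ?H) * 2 powr (- n / 16) = (\<Sum>A\<in>?H. 2 powr (- n / 16))" by simp
  also have "\<dots> \<le> (\<Sum>A\<in>?H. ?t ^ card (sym_diff A A0))"
  proof (rule sum_mono)
    fix A assume "A \<in> ?H"
    then have h: "64 * real (card (sym_diff A A0)) \<le> n" by auto
    have "?t ^ card (sym_diff A A0) = (2 powr (-4)) powr card (sym_diff A A0)"
      by (simp add: powr_realpow powr_minus_divide powr_numeral)
    also have "\<dots> = 2 powr (- 4 * real (card (sym_diff A A0)))"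
      by (simp only: powr_powr)
    also have "\<dots> \<ge> 2 powr (- n / 16)" using h by (intro powr_mono) auto
    finally show "2 powr (- n / 16) \<le> ?t ^ card (sym_diff A A0)" .
  qed
  also have "\<dots> \<le> (\<Sum>A\<in>Pow {..<n}. ?t ^ card (sym_diff A A0))"
    by (intro sum_mono2) auto
  also have "\<dots> = (\<Sum>A\<in>Pow {..<n}. ?t ^ card A)"
    using bij by (rule sum.reindex_bij_betw)
  also have "\<dots> = (1 + ?t) ^ n"
    using prod_add[of "{..<n}" "\<lambda>_. ?t" "\<lambda>_. 1"] by (simp add: add.commute)
  also have "\<dots> \<le> 2 powr (n / 8)"
  proof -
    have "(1 + ?t) ^ n = (1 + ?t) powr n" by (simp add: powr_realpow)
    also have "1 + ?t \<le> (2::real) powr (1/8)"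
    proof -
      have "(1 + ?t) ^ 8 \<le> 2" by (simp add: power_divide)
      then have "((1 + ?t) ^ 8) powr (1/8) \<le> 2 powr (1/8)"
        by (intro powr_mono2) auto
      also have "(1 + ?t) ^ 8 = (1 + ?t) powr 8" by simp
      finally show ?thesis unfolding powr_powr by simp
    qed
    then have "(1 + ?t) powr n \<le> (2 powr (1/8)) powr n" by (intro powr_mono2) auto
    also have "\<dots> = 2 powr (n / 8)" by (simp add: powr_powr)
    finally show ?thesis .
  qed
  finally have "real (card ?H) * 2 powr (- n / 16) * 2 powr (n / 16) \<le> 2 powr (n / 8) * 2 powr (n / 16)"
    by (intro mult_right_mono) auto
  then show ?thesis by (simp add: powr_add[symmetric] mult.assoc)
qed

section \<open>Sign vectors in dilated polytopes\<close>

lemma ip_diff_le: "ip (a - b) (a - b) \<le> 2 * ip a a + 2 * ip b b"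
proof -
  have "0 \<le> ip (a + b) (a + b)" by (rule ip_nonneg)
  then show ?thesis by (simp add: ip_simps ip_commute[of b a])
qed

text \<open>The norm of the type is the l1 norm, so convexity of Euclidean balls is derived from a
  parallelogram-type identity for \<open>ip\<close>.\<close>

lemma convex_ip_ball: "convex {z. ip (w - z) (w - z) \<le> R}"
proof (rule convexI)
  fix x y :: fvec and u v :: real
  assume x: "x \<in> {z. ip (w - z) (w - z) \<le> R}" and y: "y \<in> {z. ip (w - z) (w - z) \<le> R}"
    and uv: "0 \<le> u" "0 \<le> v" "u + v = 1"
  define a b where "a = w - x" and "b = w - y"
  have "w - (u *\<^sub>R x + v *\<^sub>R y) = u *\<^sub>R a + v *\<^sub>R b"
  proof -
    have "w = u *\<^sub>R w + v *\<^sub>R w" using uv by (simp flip: scaleR_add_left)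
    then show ?thesis by (simp add: a_def b_def scaleR_diff_right)
  qed
  moreover have "ip (u *\<^sub>R a + v *\<^sub>R b) (u *\<^sub>R a + v *\<^sub>R b)
      = (u + v) * (u * ip a a + v * ip b b) - u * v * ip (a - b) (a - b)"
    by (simp add: ip_simps ip_commute[of b a] algebra_simps)
  moreover have "\<dots> \<le> u * R + v * R"
    using x y uv ip_nonneg[of "a - b"] unfolding a_def[symmetric] b_def[symmetric]
    by (simp add: a_def b_def add_mono mult_left_mono add.commute add_increasing2 diff_le_eq)
  ultimately show "u *\<^sub>R x + v *\<^sub>R y \<in> {z. ip (w - z) (w - z) \<le> R}"
    using uv by (simp flip: distrib_right)
qed

lemma ip_diff_hull_le:
  assumes "z \<in> convex hull V" "w \<in> V" "\<And>v. v \<in> V \<Longrightarrow> ip v v \<le> r"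
  shows "ip (w - z) (w - z) \<le> 4 * r"
proof -
  have "ip (w - v) (w - v) \<le> 4 * r" if "v \<in> V" for v
    using ip_diff_le[of w v] assms(3)[OF that] assms(3)[OF assms(2)] by linarith
  then have "convex hull V \<subseteq> {z. ip (w - z) (w - z) \<le> 4 * r}"
    by (intro hull_minimal convex_ip_ball) auto
  then show ?thesis using assms(1) by auto
qed

text \<open>
  A derandomised form of Maurey's empirical method: the next point can always be chosen at an
  obtuse angle to the accumulated error.
\<close>

lemma maurey_approximation:
  assumes V: "finite V" and x: "x \<in> convex hull V"
    and R: "\<And>v. v \<in> V \<Longrightarrow> ip (v - x) (v - x) \<le> R"
  shows "\<exists>c\<in>V \<rightarrow>\<^sub>E UNIV. sum c V = (k::nat) \<and>
    ip ((\<Sum>v\<in>V. real (c v) *\<^sub>R v) - real k *\<^sub>R x) ((\<Sum>v\<in>V. real (c v) *\<^sub>R v) - real k *\<^sub>R x) \<le> k * R"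
proof (induction k)
  case 0
  show ?case
    by (intro bexI[of _ "restrict (\<lambda>_. 0) V"]) (simp_all add: ip_zero_left)
next
  case (Suc k)
  then obtain c where c: "c \<in> V \<rightarrow>\<^sub>E UNIV" "sum c V = k"
    and le: "ip ((\<Sum>v\<in>V. real (c v) *\<^sub>R v) - real k *\<^sub>R x) ((\<Sum>v\<in>V. real (c v) *\<^sub>R v) - real k *\<^sub>R x) \<le> k * R"
    by blast
  define s where "s = (\<Sum>v\<in>V. real (c v) *\<^sub>R v) - real k *\<^sub>R x"
  obtain u where u: "\<forall>v\<in>V. 0 \<le> u v" "sum u V = 1" "(\<Sum>v\<in>V. u v *\<^sub>R v) = x"
    using x unfolding convex_hull_finite[OF V] by auto
  \<comment> \<open>The average of \<open>ip s (v - x)\<close> with the weights representing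
    \<open>x\<close> is \<open>ip s 0 = 0\<close>, so the values cannot all be positive.\<close>
  have "\<exists>v\<in>V. ip s (v - x) \<le> 0"
  proof (rule ccontr)
    assume "\<not> ?thesis"
    then have pos: "\<forall>v\<in>V. 0 < ip s (v - x)" by auto
    have "(\<Sum>v\<in>V. u v * ip s (v - x)) = ip s (\<Sum>v\<in>V. u v *\<^sub>R (v - x))"
      by (simp add: ip_sum_right ip_scaleR_right)
    also have "(\<Sum>v\<in>V. u v *\<^sub>R (v - x)) = 0"
      using u by (simp add: scaleR_diff_right sum_subtractf flip: scaleR_sum_left)
    finally have "(\<Sum>v\<in>V. u v * ip s (v - x)) = 0" by (simp add: ip_zero_right)
    moreover have "\<forall>v\<in>V. 0 \<le> u v * ip s (v - x)" using u(1) pos by (simp add: less_imp_le)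
    ultimately have "\<forall>v\<in>V. u v * ip s (v - x) = 0"
      using sum_nonneg_eq_0_iff[OF V, of "\<lambda>v. u v * ip s (v - x)"] by simp
    then have "\<forall>v\<in>V. u v = 0" using pos by force
    then show False using u(2) by simp
  qed
  then obtain w where w: "w \<in> V" "ip s (w - x) \<le> 0" by blast
  let ?c = "c(w := Suc (c w))"
  have "(\<Sum>v\<in>V. real (?c v) *\<^sub>R v) = (\<Sum>v\<in>V. real (c v) *\<^sub>R v + (if v = w then w else 0))"
    by (intro sum.cong) (auto simp: algebra_simps)
  also have "\<dots> = (\<Sum>v\<in>V. real (c v) *\<^sub>R v) + w"
    using w(1) V by (simp add: sum.distrib)
  finally have err: "(\<Sum>v\<in>V. real (?c v) *\<^sub>R v) - real (Suc k) *\<^sub>R x = s + (w - x)"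
    by (simp add: s_def algebra_simps)
  have "ip (s + (w - x)) (s + (w - x)) = ip s s + 2 * ip s (w - x) + ip (w - x) (w - x)"
    by (simp add: ip_add_left ip_add_right ip_commute[of "w - x" s])
  also have "\<dots> \<le> Suc k * R"
    using le w(2) R[OF w(1)] unfolding s_def[symmetric] by (simp add: algebra_simps)
  finally have "ip (s + (w - x)) (s + (w - x)) \<le> Suc k * R" .
  moreover have "sum ?c V = (\<Sum>v\<in>V. c v + (if v = w then 1 else 0))"
    by (intro sum.cong) auto
  then have "sum ?c V = Suc k"
    using w(1) V c(2) by (simp add: sum.distrib)
  moreover have "?c \<in> V \<rightarrow>\<^sub>E UNIV" using c(1) w(1) by (auto simp: PiE_iff extensional_def)
  ultimately show ?case
    by (intro bexI[of _ ?c] conjI) (simp_all only: err)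
qed

section \<open>Sign vectors and their Hamming distance\<close>

definition sign_vector :: "nat \<Rightarrow> nat set \<Rightarrow> fvec" where
  "sign_vector n A = (\<Sum>i<n. Poly_Mapping.single i (if i \<in> A then 1 else - 1))"

lemma lookup_sign_vector:
  "lk (sign_vector n A) i = (if i < n then if i \<in> A then 1 else - 1 else 0)"
  by (simp add: sign_vector_def lookup_sum lookup_single_1)

lemma sign_vector_in_Rn: "sign_vector n A \<in> Rn n"
  by (simp add: Rn_iff lookup_sign_vector)

lemma ip_Rn: "x \<in> Rn n \<Longrightarrow> ip x y = (\<Sum>i<n. lk x i * lk y i)"
  by (rule ip_eq_sum_left) (auto simp: Rn_def)

lemma ip_sign_vector_diff:
  assumes "A \<subseteq> {..<n}" "B \<subseteq> {..<n}"
  shows "ip (sign_vector n A - sign_vector n B) (sign_vector n A - sign_vector n B)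
    = 4 * card (sym_diff A B)"
proof -
  have "sign_vector n A - sign_vector n B \<in> Rn n"
    by (simp add: subspace_Rn subspace_diff sign_vector_in_Rn)
  then have "ip (sign_vector n A - sign_vector n B) (sign_vector n A - sign_vector n B)
    = (\<Sum>i<n. if i \<in> sym_diff A B then 4 else 0)"
    by (auto simp: ip_Rn lookup_minus lookup_sign_vector intro!: sum.cong)
  also have "\<dots> = (\<Sum>i\<in>{..<n} \<inter> sym_diff A B. 4)" by (subst sum.inter_restrict) simp_all
  also have "{..<n} \<inter> sym_diff A B = sym_diff A B" using assms by auto
  finally show ?thesis by simp
qed

text \<open>Maurey's method assigns to each sign vector a multiset of \<open>k\<close> vertices
  whose average is close to the vector divided by \<open>\<rho>\<close>. Sign vectors sharing a
  multiset lie in one Hamming ball, so the count is at most the number of multisets times the size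
  of a ball.\<close>

lemma card_sign_vectors_in_hull_le:
  assumes V: "finite V" "V \<noteq> {}" and r: "\<And>v. v \<in> V \<Longrightarrow> ip v v \<le> real n"
    and k: "k \<ge> 1" "256 * \<rho>\<^sup>2 \<le> real k"
  shows "real (card {A. A \<subseteq> {..<n} \<and> sign_vector n A \<in> (\<lambda>x. \<rho> *\<^sub>R x) ` (convex hull V)})
     \<le> (exp 1 * (card V + k) / k) ^ k * 2 powr (3 * real n / 16)"
proof -
  let ?T = "{A. A \<subseteq> {..<n} \<and> sign_vector n A \<in> (\<lambda>x. \<rho> *\<^sub>R x) ` (convex hull V)}"
  let ?C = "{c \<in> V \<rightarrow>\<^sub>E UNIV. sum c V = k}"
  define err where "err c z = ip ((\<Sum>v\<in>V. real (c v) *\<^sub>R v) - real k *\<^sub>R z)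
      ((\<Sum>v\<in>V. real (c v) *\<^sub>R v) - real k *\<^sub>R z)" for c :: "fvec \<Rightarrow> nat" and z
  have "\<exists>z c. sign_vector n A = \<rho> *\<^sub>R z \<and> c \<in> ?C \<and>
      err c z \<le> real k * (4 * real n)"
    if A: "A \<in> ?T" for A
  proof -
    obtain z where z: "sign_vector n A = \<rho> *\<^sub>R z" "z \<in> convex hull V" using A by auto
    have "\<And>v. v \<in> V \<Longrightarrow> ip (v - z) (v - z) \<le> 4 * real n"
      by (rule ip_diff_hull_le[OF z(2)]) (simp_all add: r)
    then obtain c where "c \<in> ?C"
      "err c z \<le> real k * (4 * real n)"
      using maurey_approximation[OF V(1) z(2), of "4 * real n" k] unfolding err_def by auto
    then show ?thesis using z(1) by blast
  qed
  then have "\<forall>A\<in>?T. \<exists>p. sign_vector n A = \<rho> *\<^sub>R fst p \<and> snd p \<in> ?C \<and> err (snd p) (fst p) \<le> real k * (4 * real n)"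
    by auto
  then obtain p where p: "\<forall>A\<in>?T. sign_vector n A = \<rho> *\<^sub>R fst (p A) \<and> snd (p A) \<in> ?C \<and>
      err (snd (p A)) (fst (p A)) \<le> real k * (4 * real n)"
    by (rule bchoice[THEN exE])
  define z c where "z A = fst (p A)" and "c A = snd (p A)" for A
  have z: "sign_vector n A = \<rho> *\<^sub>R z A" and c: "c A \<in> ?C"
    and le: "err (c A) (z A) \<le> real k * (4 * real n)" if "A \<in> ?T" for A
    using p[rule_format, OF that] by (simp_all add: z_def c_def)
  have fib: "real (card {A \<in> ?T. c A = d}) \<le> 2 powr (3 * real n / 16)" for d
  proof (cases "{A \<in> ?T. c A = d} = {}")
    case False
    then obtain A0 where A0: "A0 \<in> ?T" "c A0 = d" by blast
    have "64 * card (sym_diff A A0) \<le> n" if A: "A \<in> ?T" "c A = d" for A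
    proof -
      define s where "s = (\<Sum>v\<in>V. real (d v) *\<^sub>R v)"
      \<comment> \<open>The common vertex sum \<open>s\<close> cancels, leaving two Maurey errors.
        With \<open>256 * \<rho>\<^sup>2 \<le> k\<close> and squared distance
        \<open>4 * card (sym_diff A A0)\<close> between the sign vectors this becomes Hamming
        distance at most \<open>n / 64\<close>.\<close>
      have "real k ^ 2 * ip (z A - z A0) (z A - z A0)
          = ip ((s - real k *\<^sub>R z A0) - (s - real k *\<^sub>R z A)) ((s - real k *\<^sub>R z A0) - (s - real k *\<^sub>R z A))"
        by (simp add: power2_eq_square ip_simps algebra_simps)
      also have "\<dots> \<le> 2 * (real k * (4 * real n)) + 2 * (real k * (4 * real n))"
        using ip_diff_le[of "s - real k *\<^sub>R z A0" "s - real k *\<^sub>R z A"] le[OF A(1)] le[OF A0(1)]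
        unfolding A(2) A0(2) err_def s_def[symmetric] by linarith
      finally have "real k * ip (z A - z A0) (z A - z A0) \<le> 16 * n"
        using k(1) by (simp add: power2_eq_square mult.assoc)
      moreover have "256 * \<rho>\<^sup>2 * ip (z A - z A0) (z A - z A0) \<le> real k * ip (z A - z A0) (z A - z A0)"
        using k(2) ip_nonneg by (rule mult_right_mono)
      moreover have "\<rho>\<^sup>2 * ip (z A - z A0) (z A - z A0)
          = ip (sign_vector n A - sign_vector n A0) (sign_vector n A - sign_vector n A0)"
        unfolding z[OF A(1)] z[OF A0(1)] scaleR_diff_right[symmetric]
        by (simp only: ip_scaleR_left ip_scaleR_right power2_eq_square mult.assoc)
      moreover have "\<dots> = 4 * card (sym_diff A A0)"
        using A(1) A0(1) by (intro ip_sign_vector_diff) auto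
      ultimately show ?thesis by linarith
    qed
    then have "{A \<in> ?T. c A = d} \<subseteq> {A. A \<subseteq> {..<n} \<and> 64 * card (sym_diff A A0) \<le> n}" by blast
    then have "card {A \<in> ?T. c A = d} \<le> card {A. A \<subseteq> {..<n} \<and> 64 * card (sym_diff A A0) \<le> n}"
      by (intro card_mono) auto
    then show ?thesis using card_hamming_ball_le[of A0 n] A0(1) by force
  next
    case True
    show ?thesis unfolding True by simp
  qed
  have fT: "finite ?T" by (rule finite_subset[of _ "Pow {..<n}"]) auto
  have "real (card ?T) = (\<Sum>A\<in>?T. 1)" by simp
  also have "\<dots> = (\<Sum>d\<in>?C. \<Sum>A\<in>{A \<in> ?T. c A = d}. 1)"
    using fT card_weak_compositions_le(1)[OF V(1) k(1) V(2)] c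
    by (intro sum.group[symmetric]) auto
  also have "\<dots> = (\<Sum>d\<in>?C. real (card {A \<in> ?T. c A = d}))" by simp
  also have "\<dots> \<le> (\<Sum>d\<in>?C. 2 powr (3 * real n / 16))" by (intro sum_mono fib)
  also have "\<dots> = real (card ?C) * 2 powr (3 * real n / 16)" by simp
  also have "\<dots> \<le> (exp 1 * (card V + k) / k) ^ k * 2 powr (3 * real n / 16)"
    using card_weak_compositions_le(2)[OF V(1) k(1) V(2)] by (intro mult_right_mono) auto
  finally show ?thesis .
qed

section \<open>Lifting vertices to the simplex\<close>

text \<open>The coefficients may be negative. Translating by one of the points turns
  \<open>F\<close> into a subspace.\<close>

lemma affine_sum_mem:
  assumes F: "affine F" and I: "finite I" "sum \<mu> I = 1" and f: "\<And>i. i \<in> I \<Longrightarrow> f i \<in> F"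
  shows "(\<Sum>i\<in>I. \<mu> i *\<^sub>R f i) \<in> F"
proof -
  obtain i0 where i0: "i0 \<in> I" using I(2) by (metis sum.empty equals0I zero_neq_one)
  have sub: "subspace ((\<lambda>x. x - f i0) ` F)"
    using affine_diffs_subspace_subtract[OF F f[OF i0]] .
  have "(\<Sum>i\<in>I. \<mu> i *\<^sub>R (f i - f i0)) \<in> (\<lambda>x. x - f i0) ` F"
    using f by (intro subspace_sum[OF sub] subspace_scale[OF sub]) auto
  moreover have "(\<Sum>i\<in>I. \<mu> i *\<^sub>R (f i - f i0)) = (\<Sum>i\<in>I. \<mu> i *\<^sub>R f i) - f i0"
    using I(2) by (simp add: scaleR_diff_right sum_subtractf flip: scaleR_sum_left)
  ultimately show ?thesis by auto
qed

lemma uminus_mem_hull: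
  assumes "uminus ` V = V" "x \<in> convex hull V"
  shows "- x \<in> convex hull (V :: 'a::real_vector set)"
proof -
  have "linear (uminus :: 'a \<Rightarrow> 'a)" by (rule linear_uminus)
  then have "uminus ` (convex hull V) = convex hull (uminus ` V)"
    by (rule convex_hull_linear_image)
  then show ?thesis using assms by auto
qed

text \<open>
  The numbers \<open>q v j\<close> are the barycentric coordinates of a lift of the vertex \<open>v\<close> to the section
  of the simplex; nothing else about the projected section is needed to prove the lower bound.
\<close>

definition slack_system :: "nat \<Rightarrow> 'a::real_vector set \<Rightarrow> real \<Rightarrow> ('a \<Rightarrow> nat \<Rightarrow> real) \<Rightarrow> bool" where
  "slack_system N V \<rho> q \<longleftrightarrow> (\<forall>v\<in>V. \<forall>j\<le>N. 0 \<le> q v j) \<and>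
    (\<forall>\<mu>. sum \<mu> V = 1 \<and> (\<forall>j\<le>N. 0 \<le> (\<Sum>v\<in>V. \<mu> v * q v j)) \<longrightarrow>
      (\<Sum>v\<in>V. \<mu> v *\<^sub>R v) \<in> (\<lambda>x. \<rho> *\<^sub>R x) ` (convex hull V))"

text \<open>
  With \<open>B = convex hull V\<close>, symmetry gives \<open>(l - 1) a \<in> l B\<close>, hence
  \<open>l (B - a) + a \<subseteq> 2 l B\<close>: the centre \<open>a\<close> costs only a factor 2.
\<close>

lemma body_from_simplex_slack_system:
  assumes body: "body_from_simplex n N K"
    and V: "finite V" "V \<noteq> {}" "uminus ` V = V"
    and T: "linear T"
    and in1: "(\<lambda>x. x - a) ` (convex hull V) \<subseteq> T ` (\<lambda>x. x - b) ` K"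
    and in2: "T ` (\<lambda>x. x - b) ` K \<subseteq> (\<lambda>x. l *\<^sub>R x) ` (\<lambda>x. x - a) ` (convex hull V)"
  shows "\<exists>q. slack_system N V (2 * l) q"
proof -
  let ?B = "convex hull V"
  obtain S \<phi> where S: "proj_of_section_of_simplex N S"
    and \<phi>: "affine_identification n (affine hull S) \<phi>" and K: "K = \<phi> ` S"
    using body unfolding body_from_simplex_def by blast
  obtain F E where FE: "affine F" "subspace E" "E \<subseteq> Rn (N + 1)"
    and SFE: "S = orth_proj E ` (std_simplex N \<inter> F)"
    using S unfolding proj_of_section_of_simplex_def by blast
  obtain L w where L: "linear L" and Lw: "\<forall>x\<in>affine hull S. \<phi> x = L x + w"
    using \<phi> unfolding affine_identification_def by blast
  \<comment> \<open>On the section, \<open>p \<mapsto> H p + d\<close> is the composed map from the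
    simplex to the coordinates of \<open>convex hull V\<close>; being affine, it commutes with the
    affine combinations below.\<close>
  define H where "H = T \<circ> L \<circ> orth_proj E"
  define d where "d = T w - T b + a"
  have H: "linear H"
    unfolding H_def using T L linear_orth_proj[OF FE(2,3)] by (intro linear_compose)
  have H_eq: "H p + d = T (\<phi> (orth_proj E p) - b) + a" if "p \<in> std_simplex N \<inter> F" for p
  proof -
    have "orth_proj E p \<in> affine hull S" using that SFE hull_inc by (metis imageI)
    then show ?thesis
      using Lw by (simp add: H_def d_def linear_add[OF T] linear_diff[OF T])
  qed
  have "\<forall>v\<in>V. \<exists>p. p \<in> std_simplex N \<inter> F \<and> v = H p + d"
  proof
    fix v assume "v \<in> V"
    then have "v - a \<in> (\<lambda>x. x - a) ` ?B" by (intro imageI hull_inc)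
    then have "v - a \<in> T ` (\<lambda>x. x - b) ` K" using in1 by blast
    then obtain p where "p \<in> std_simplex N \<inter> F" "v - a = T (\<phi> (orth_proj E p) - b)"
      unfolding K SFE by blast
    then show "\<exists>p. p \<in> std_simplex N \<inter> F \<and> v = H p + d"
      using H_eq by (metis diff_add_cancel)
  qed
  then obtain p where p: "\<And>v. v \<in> V \<Longrightarrow> p v \<in> std_simplex N \<inter> F" "\<And>v. v \<in> V \<Longrightarrow> v = H (p v) + d"
    by metis
  obtain v0 where v0: "v0 \<in> V" using V(2) by blast
  \<comment> \<open>Both inclusions together send \<open>B - a\<close> into
    \<open>l (B - a)\<close>. Used at \<open>v0\<close> and \<open>- v0\<close>, the two equations
    add up to one for \<open>a\<close> in terms of \<open>b2\<close> and \<open>b3\<close>.\<close>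
  have step: "\<exists>y\<in>?B. x - a = l *\<^sub>R (y - a)" if "x \<in> ?B" for x
    using in1 in2 that by blast
  obtain b2 where b2: "b2 \<in> ?B" "v0 - a = l *\<^sub>R (b2 - a)"
    using step[of v0] v0 by (auto simp: hull_inc)
  obtain b3 where b3: "b3 \<in> ?B" "- v0 - a = l *\<^sub>R (b3 - a)"
    using step[of "- v0"] uminus_mem_hull[OF V(3) hull_inc[OF v0]] by blast
  have "slack_system N V (2 * l) (\<lambda>v. lk (p v))"
    unfolding slack_system_def
  proof (intro conjI allI impI ballI)
    fix v j assume "v \<in> V" "j \<le> N"
    then show "0 \<le> lk (p v) j" using p(1) std_simplex_iff by blast
  next
    fix \<mu> assume l: "sum \<mu> V = 1 \<and> (\<forall>j\<le>N. 0 \<le> (\<Sum>v\<in>V. \<mu> v * lk (p v) j))"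
    define P where "P = (\<Sum>v\<in>V. \<mu> v *\<^sub>R p v)"
    have "P \<in> F"
      unfolding P_def using FE(1) V(1) l p(1) by (intro affine_sum_mem) auto
    moreover have "P \<in> std_simplex N"
      unfolding std_simplex_iff
    proof (intro conjI allI impI)
      show "P \<in> Rn (N + 1)"
        unfolding P_def using p(1) std_simplex_iff
        by (intro subspace_sum subspace_scale subspace_Rn) blast
      show "0 \<le> lk P i" if "i \<le> N" for i
        using l that by (simp add: P_def lookup_sum)
      have "(\<Sum>i\<le>N. lk P i) = (\<Sum>v\<in>V. \<mu> v * (\<Sum>i\<le>N. lk (p v) i))"
        unfolding P_def by (simp add: lookup_sum sum_distrib_left) (rule sum.swap)
      also have "\<dots> = (\<Sum>v\<in>V. \<mu> v)"
        using p(1) std_simplex_iff by (intro sum.cong) auto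
      finally show "(\<Sum>i\<le>N. lk P i) = 1" using l by simp
    qed
    ultimately have P: "P \<in> std_simplex N \<inter> F" by simp
    then have "T (\<phi> (orth_proj E P) - b) \<in> T ` (\<lambda>x. x - b) ` K"
      unfolding K SFE by blast
    then obtain b1 where b1: "b1 \<in> ?B" "T (\<phi> (orth_proj E P) - b) = l *\<^sub>R (b1 - a)"
      using in2 by blast
    have "(\<Sum>v\<in>V. \<mu> v *\<^sub>R v) = (\<Sum>v\<in>V. \<mu> v *\<^sub>R (H (p v) + d))"
      using p(2) by (intro sum.cong) auto
    also have "\<dots> = H P + d"
      using l by (simp add: P_def linear_sum[OF H] linear_cmul[OF H] scaleR_add_right sum.distrib
          flip: scaleR_sum_left)
    also have "\<dots> = l *\<^sub>R (b1 - a) + a" using H_eq[OF P] b1(2) by simp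
    also have "\<dots> = (2 * l) *\<^sub>R ((1/2) *\<^sub>R b1 + (1/2) *\<^sub>R ((1/2) *\<^sub>R (- b2) + (1/2) *\<^sub>R (- b3)))"
    proof -
      have "2 *\<^sub>R a = - ((v0 - a) + (- v0 - a))" by (simp add: scaleR_2)
      also have "\<dots> = - l *\<^sub>R (b2 - a) - l *\<^sub>R (b3 - a)" unfolding b2(2) b3(2) by simp
      finally have "(1/2) *\<^sub>R 2 *\<^sub>R a = (1/2) *\<^sub>R (- l *\<^sub>R (b2 - a) - l *\<^sub>R (b3 - a))" by simp
      then have "a = (1/2) *\<^sub>R (- l *\<^sub>R (b2 - a) - l *\<^sub>R (b3 - a))" by simp
      also have "\<dots> = l *\<^sub>R a - (l/2) *\<^sub>R b2 - (l/2) *\<^sub>R b3"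
        by (simp add: algebra_simps) (simp flip: scaleR_add_left)
      finally have "a = l *\<^sub>R a - (l/2) *\<^sub>R b2 - (l/2) *\<^sub>R b3" .
      then have "l *\<^sub>R (b1 - a) + a = l *\<^sub>R (b1 - a) + (l *\<^sub>R a - (l/2) *\<^sub>R b2 - (l/2) *\<^sub>R b3)"
        by simp
      then show ?thesis by (simp add: algebra_simps)
    qed
    also have "\<dots> \<in> (\<lambda>x. (2 * l) *\<^sub>R x) ` ?B"
      using b1(1) uminus_mem_hull[OF V(3) b2(1)] uminus_mem_hull[OF V(3) b3(1)]
      by (intro imageI convexD[OF convex_convex_hull]) auto
    finally show "(\<Sum>v\<in>V. \<mu> v *\<^sub>R v) \<in> (\<lambda>x. (2 * l) *\<^sub>R x) ` ?B" .
  qed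
  then show ?thesis by blast
qed

section \<open>Encoding lifts\<close>

text \<open>
  The constant entry \<open>1\<close> makes every integer combination that decodes to a sign vector an affine
  combination. Where the maximum vanishes, \<open>x / 0 = 0\<close> gives the correct entry \<open>0\<close>.
\<close>

definition slack_code :: "nat \<Rightarrow> nat \<Rightarrow> fvec set \<Rightarrow> (fvec \<Rightarrow> nat \<Rightarrow> real) \<Rightarrow> fvec \<Rightarrow> nat + nat \<Rightarrow> int" where
  "slack_code N P V q v = case_sum (\<lambda>i. \<lfloor>lk v i\<rfloor>)
     (\<lambda>j. if j \<le> N then \<lfloor>real P * (q v j / Max ((\<lambda>w. q w j) ` V))\<rfloor> else 1)"

text \<open>
  The integer combination \<open>\<Sum>A - \<Sum>A'\<close> of lifts may leave the simplex slightly. Averaging it with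
  a point all of whose nonzero slacks are at least \<open>1 / (N + 1)\<close> of their maximum repairs this.
\<close>

lemma slack_decode:
  assumes q: "slack_system N V \<rho> q" and V: "finite V" "uminus ` V = V" and \<rho>: "0 \<le> \<rho>"
    and S: "S \<subseteq> V" "card S * (N + 1) \<le> P" "0 < P" and A: "A \<subseteq> S" "A' \<subseteq> S"
    and nn: "\<And>j. j \<le> N \<Longrightarrow> 0 \<le> (\<Sum>v\<in>A. slack_code N P V q v (Inr j)) - (\<Sum>v\<in>A'. slack_code N P V q v (Inr j))"
    and card: "int (card A) - int (card A') = 1"
  shows "(\<Sum>v\<in>A. v) - (\<Sum>v\<in>A'. v) \<in> (\<lambda>x. (2 * \<rho> + 1) *\<^sub>R x) ` (convex hull V)"
proof -
  have fS: "finite S" using S(1) V(1) by (rule finite_subset)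
  have AV: "A \<subseteq> V" "A' \<subseteq> V" using S(1) A by auto
  have "A \<noteq> {}" using card by auto
  then have Vne: "V \<noteq> {}" using AV by blast
  define m where "m j = Max ((\<lambda>w. q w j) ` V)" for j
  define y where "y v j = q v j / m j" for v j
  have q0: "0 \<le> q v j" if "v \<in> V" "j \<le> N" for v j
    using q that by (simp add: slack_system_def)
  have qm: "q v j \<le> m j" if "v \<in> V" for v j
    unfolding m_def using V that by simp
  have "\<exists>v\<in>V. q v j = m j" for j
  proof -
    have "m j \<in> (\<lambda>w. q w j) ` V" unfolding m_def using V Vne by (intro Max_in) auto
    then show ?thesis by auto
  qed
  then obtain top where top: "\<And>j. top j \<in> V" "\<And>j. q (top j) j = m j" by metis
  \<comment> \<open>Half of the integer combination plus half of the average of the maximisers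
    \<open>top j\<close>. The inner sum counts multiplicity, as one vertex may maximise several
    slacks.\<close>
  define \<mu> where "\<mu> v = (1/2) * (of_bool (v \<in> A) - of_bool (v \<in> A') + (1 / real (N + 1)) * (\<Sum>j\<le>N. of_bool (v = top j)))" for v
  have restr: "(\<Sum>v\<in>V. of_bool (v \<in> X) *\<^sub>R f v) = (\<Sum>v\<in>X. f v)" if "X \<subseteq> V" for X and f :: "fvec \<Rightarrow> 'b::real_vector"
  proof -
    have "(\<Sum>v\<in>X. f v) = (\<Sum>v\<in>X. of_bool (v \<in> X) *\<^sub>R f v)" by (intro sum.cong) auto
    also have "\<dots> = (\<Sum>v\<in>V. of_bool (v \<in> X) *\<^sub>R f v)"
      using V that by (intro sum.mono_neutral_left) auto
    finally show ?thesis by simp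
  qed
  have topsum: "(\<Sum>v\<in>V. (\<Sum>j\<le>N. of_bool (v = top j)) *\<^sub>R f v) = (\<Sum>j\<le>N. f (top j))" for f :: "fvec \<Rightarrow> 'b::real_vector"
  proof -
    have "(\<Sum>v\<in>V. (\<Sum>j\<le>N. of_bool (v = top j)) *\<^sub>R f v) = (\<Sum>j\<le>N. \<Sum>v\<in>V. of_bool (v \<in> {top j}) *\<^sub>R f v)"
      unfolding scaleR_sum_left by (subst sum.swap) simp
    also have "\<dots> = (\<Sum>j\<le>N. f (top j))"
      using top(1) by (intro sum.cong refl) (subst restr, auto)
    finally show ?thesis .
  qed
  \<comment> \<open>One identity, read with \<open>f\<close> constant \<open>1\<close> for the total
    mass, with the scaled slacks, and with the identity for the resulting point.\<close>
  have \<mu>: "(\<Sum>v\<in>V. \<mu> v *\<^sub>R f v) = (1/2) *\<^sub>R ((\<Sum>v\<in>A. f v) - (\<Sum>v\<in>A'. f v) + (1 / real (N + 1)) *\<^sub>R (\<Sum>j\<le>N. f (top j)))"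
    for f :: "fvec \<Rightarrow> 'b::real_vector"
  proof -
    have "(\<Sum>v\<in>V. \<mu> v *\<^sub>R f v) = (\<Sum>v\<in>V. (1/2) *\<^sub>R (of_bool (v \<in> A) *\<^sub>R f v - of_bool (v \<in> A') *\<^sub>R f v
        + (1 / real (N + 1)) *\<^sub>R (\<Sum>j\<le>N. of_bool (v = top j)) *\<^sub>R f v))"
      by (simp only: \<mu>_def scaleR_scaleR[symmetric] scaleR_add_left scaleR_diff_left)
    then show ?thesis
      by (simp only: restr[OF AV(1)] restr[OF AV(2)] topsum scaleR_sum_right[symmetric] sum.distrib sum_subtractf)
  qed
  define x1 where "x1 = (\<Sum>v\<in>A. v) - (\<Sum>v\<in>A'. v)"
  define x2 where "x2 = (1 / real (N + 1)) *\<^sub>R (\<Sum>j\<le>N. top j)"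
  have "sum \<mu> V = 1"
  proof -
    have "real (card A) - real (card A') = 1" using card by linarith
    then show ?thesis using \<mu>[of "\<lambda>_. 1 :: real"] by simp
  qed
  moreover have "0 \<le> (\<Sum>v\<in>V. \<mu> v * q v j)" if j: "j \<le> N" for j
  proof (cases "m j = 0")
    case True
    then have "q v j = 0" if "v \<in> V" for v using q0[OF that j] qm[OF that, of j] by simp
    then show ?thesis by simp
  next
    case False
    then have mj: "0 < m j" using q0[OF top(1) j] top(2)[of j] by (metis less_eq_real_def)
    let ?f = "\<lambda>v. slack_code N P V q v (Inr j)"
    have f: "?f v = \<lfloor>real P * y v j\<rfloor>" for v
      using j by (simp add: slack_code_def y_def m_def)
    have "0 \<le> real_of_int ((\<Sum>v\<in>A. ?f v) - (\<Sum>v\<in>A'. ?f v))"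
      using nn[OF j] by (simp only: of_int_0_le_iff)
    then have "0 \<le> (\<Sum>v\<in>A. real_of_int (?f v)) - (\<Sum>v\<in>A'. real_of_int (?f v))"
      by (simp only: of_int_diff of_int_sum)
    \<comment> \<open>Replacing floors by exact values can only raise the sum over \<open>A\<close>;
      over \<open>A'\<close> it costs at most one unit per vertex.\<close>
    also have "\<dots> \<le> (\<Sum>v\<in>A. real P * y v j) - (\<Sum>v\<in>A'. real P * y v j - 1)"
      unfolding f by (intro diff_mono sum_mono) linarith+
    also have "\<dots> = P * ((\<Sum>v\<in>A. y v j) - (\<Sum>v\<in>A'. y v j)) + card A'"
      by (simp add: sum_subtractf sum_distrib_left algebra_simps)
    finally have 1: "- real (card A') \<le> P * ((\<Sum>v\<in>A. y v j) - (\<Sum>v\<in>A'. y v j))" by simp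
    \<comment> \<open>Relative to \<open>P\<close> the rounding loss is thus at most
      \<open>1 / (N + 1)\<close>, exactly the share contributed by \<open>top j\<close>, where the
      scaled slack is \<open>1\<close>.\<close>
    have "card A' * (N + 1) \<le> P"
      using card_mono[OF fS A(2)] S(2) by (meson le_trans mult_le_mono1)
    then have "real (card A') * real (N + 1) \<le> real P" by (metis of_nat_le_iff of_nat_mult)
    then have "real (card A') \<le> P * (1 / real (N + 1))" by (simp add: field_simps)
    with 1 have "0 \<le> P * ((\<Sum>v\<in>A. y v j) - (\<Sum>v\<in>A'. y v j) + 1 / real (N + 1))"
      by (simp add: algebra_simps)
    then have "0 \<le> (\<Sum>v\<in>A. y v j) - (\<Sum>v\<in>A'. y v j) + 1 / real (N + 1)"
      using S(3) by (simp add: zero_le_mult_iff)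
    also have "1 / real (N + 1) \<le> 1 / real (N + 1) * (\<Sum>i\<le>N. y (top i) j)"
    proof -
      have "y (top j) j \<le> (\<Sum>i\<le>N. y (top i) j)"
        using j mj q0[OF top(1) j] by (intro member_le_sum) (auto simp: y_def)
      then have "1 \<le> (\<Sum>i\<le>N. y (top i) j)" using mj top(2) by (simp add: y_def)
      then show ?thesis by (simp add: divide_right_mono)
    qed
    finally have "0 \<le> (\<Sum>v\<in>A. y v j) - (\<Sum>v\<in>A'. y v j) + 1 / real (N + 1) * (\<Sum>i\<le>N. y (top i) j)"
      by simp
    then have "0 \<le> (\<Sum>v\<in>V. \<mu> v * y v j)"
      using \<mu>[of "\<lambda>v. y v j"] by simp
    moreover have "(\<Sum>v\<in>V. \<mu> v * q v j) = m j * (\<Sum>v\<in>V. \<mu> v * y v j)"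
      using mj by (simp add: y_def sum_distrib_left)
    ultimately show ?thesis using mj by simp
  qed
  ultimately have "(\<Sum>v\<in>V. \<mu> v *\<^sub>R v) \<in> (\<lambda>x. \<rho> *\<^sub>R x) ` (convex hull V)"
    using q unfolding slack_system_def by blast
  then obtain z where z: "z \<in> convex hull V" "(1/2) *\<^sub>R (x1 + x2) = \<rho> *\<^sub>R z"
    unfolding \<mu>[of "\<lambda>v. v"] x1_def x2_def by blast
  have "x2 = (\<Sum>j\<le>N. (1 / real (N + 1)) *\<^sub>R top j)" by (simp add: x2_def scaleR_sum_right)
  also have "\<dots> \<in> convex hull V"
    using top(1) by (intro convex_sum convex_convex_hull) (auto intro: hull_inc)
  finally have x2: "- x2 \<in> convex hull V" using uminus_mem_hull[OF V(2)] by blast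
  \<comment> \<open>Undoing the average: \<open>- x2\<close> is in the hull by symmetry, and the
    weights \<open>2 * \<rho>\<close> and \<open>1\<close> add up to the new factor.\<close>
  have "x1 = 2 *\<^sub>R ((1/2) *\<^sub>R (x1 + x2)) - x2" by simp
  also have "\<dots> = (2 * \<rho>) *\<^sub>R z + (- x2)" unfolding z(2) by simp
  also have "\<dots> = (2 * \<rho> + 1) *\<^sub>R ((2 * \<rho> / (2 * \<rho> + 1)) *\<^sub>R z + (1 / (2 * \<rho> + 1)) *\<^sub>R (- x2))"
  proof -
    have "2 * \<rho> + 1 \<noteq> 0" using \<rho> by simp
    then show ?thesis by (simp add: scaleR_diff_right)
  qed
  also have "\<dots> \<in> (\<lambda>x. (2 * \<rho> + 1) *\<^sub>R x) ` (convex hull V)"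
    using z(1) x2 \<rho>
    by (intro imageI convexD[OF convex_convex_hull]) (auto simp: field_simps)
  finally show ?thesis unfolding x1_def .
qed

text \<open>Neither \<open>V\<close> nor \<open>q\<close> occurs here: the decoded family depends on
  the code alone, so families of vertices can be counted by codes. The entry
  \<open>Inr (Suc N)\<close> is the constant \<open>1\<close>, which makes the combination
  affine.\<close>

definition decode :: "nat \<Rightarrow> nat \<Rightarrow> (nat + nat \<Rightarrow> int) set \<Rightarrow> nat set set" where
  "decode n N C = {A. A \<subseteq> {..<n} \<and> (\<exists>C1 C2. C1 \<subseteq> C \<and> C2 \<subseteq> C \<and>
     (\<forall>i<n. (\<Sum>h\<in>C1. h (Inl i)) - (\<Sum>h\<in>C2. h (Inl i)) = (if i \<in> A then 1 else - 1)) \<and>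
     (\<forall>j\<le>N. 0 \<le> (\<Sum>h\<in>C1. h (Inr j)) - (\<Sum>h\<in>C2. h (Inr j))) \<and>
     (\<Sum>h\<in>C1. h (Inr (Suc N))) - (\<Sum>h\<in>C2. h (Inr (Suc N))) = 1)}"

text \<open>The code consists of the rounded lifts of a dissociated set. Its spanning property
  recovers the sign vectors of \<open>V\<close>, and \<open>slack_decode\<close> confines everything
  decoded to the dilated hull. The number \<open>k0\<close> stands for any solution of the
  pigeonhole inequality.\<close>

lemma slack_code_exists:
  assumes q: "slack_system N V \<rho> q" and V: "finite V" "uminus ` V = V" and \<rho>: "0 \<le> \<rho>"
    and VR: "V \<subseteq> Rn n" and Vint: "\<And>v i. v \<in> V \<Longrightarrow> lk v i \<in> {-1, 0, 1}"
    and P: "0 < P" "k0 * (N + 1) \<le> P"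
    and k0: "\<And>k. 2 ^ k \<le> (2 * P * k + 1) ^ (n + N + 2) \<Longrightarrow> k \<le> k0"
  shows "\<exists>C. C \<subseteq> (({..<n} <+> {..Suc N}) \<rightarrow>\<^sub>E {- int P..int P}) \<and> card C \<le> k0 \<and>
     decode n N C \<subseteq> {A. A \<subseteq> {..<n} \<and> sign_vector n A \<in> (\<lambda>x. (2 * \<rho> + 1) *\<^sub>R x) ` (convex hull V)} \<and>
     {A. A \<subseteq> {..<n} \<and> sign_vector n A \<in> V} \<subseteq> decode n N C"
proof -
  let ?I = "{..<n} <+> {..Suc N} :: (nat + nat) set"
  let ?g = "slack_code N P V q"
  \<comment> \<open>The coordinates are integers, so only the slacks are changed by
    rounding.\<close>
  have lkf: "real_of_int \<lfloor>lk v i\<rfloor> = lk v i" if "v \<in> V" for v i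
  proof -
    have "lk v i = of_int (- 1) \<or> lk v i = of_int 0 \<or> lk v i = of_int 1"
      using Vint[OF that, of i] by simp
    then show ?thesis by (metis floor_of_int)
  qed
  have rng: "\<bar>?g v t\<bar> \<le> int P" if v: "v \<in> V" for v t
  proof (cases t)
    case (Inl i)
    have "real_of_int \<bar>\<lfloor>lk v i\<rfloor>\<bar> \<le> 1"
      unfolding of_int_abs lkf[OF v] using Vint[OF v, of i] by auto
    then have "\<bar>\<lfloor>lk v i\<rfloor>\<bar> \<le> 1" by linarith
    then show ?thesis using Inl P(1) by (simp add: slack_code_def)
  next
    case (Inr j)
    show ?thesis
    proof (cases "j \<le> N")
      case True
      let ?m = "Max ((\<lambda>w. q w j) ` V)"
      have q0: "0 \<le> q v j" using q v True by (simp add: slack_system_def)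
      have "q v j \<le> ?m" using V v by simp
      then have "0 \<le> q v j / ?m" "q v j / ?m \<le> 1"
        using q0 by (auto simp: divide_le_eq_1)
      then have "0 \<le> P * (q v j / ?m)" "P * (q v j / ?m) \<le> real P * 1"
        by (intro mult_nonneg_nonneg mult_left_mono; simp)+
      then have "0 \<le> \<lfloor>P * (q v j / ?m)\<rfloor>" "\<lfloor>P * (q v j / ?m)\<rfloor> \<le> int P"
        by (simp_all add: floor_le_iff)
      then show ?thesis using Inr True by (simp add: slack_code_def)
    qed (use Inr P in \<open>simp add: slack_code_def\<close>)
  qed
  obtain S where S: "S \<subseteq> V" and inj: "inj_on (\<lambda>A. restrict (\<lambda>i. \<Sum>v\<in>A. ?g v i) ?I) (Pow S)"
    and cS: "2 ^ card S \<le> (2 * P * card S + 1) ^ card ?I"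
    and span: "\<And>v. v \<in> V \<Longrightarrow> \<exists>A A'. A \<subseteq> S \<and> A' \<subseteq> S \<and> (\<forall>i\<in>?I. ?g v i = (\<Sum>w\<in>A. ?g w i) - (\<Sum>w\<in>A'. ?g w i))"
    using dissociated_spanning_subset[OF V(1), of ?I ?g P] rng by auto
  \<comment> \<open>There are \<open>n\<close> coordinates, \<open>N + 1\<close> slacks and the
    constant entry.\<close>
  have "card ?I = n + N + 2" by (simp add: card_Plus)
  then have cS: "card S \<le> k0" using cS k0 by simp
  then have cSP: "card S * (N + 1) \<le> P" using P(2) by (meson le_trans mult_le_mono1)
  have fS: "finite S" using S V finite_subset by blast
  define \<gamma> where "\<gamma> v = restrict (?g v) ?I" for v
  \<comment> \<open>Distinct sums of singletons already separate the codes, so sums over sets of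
    codes agree with sums over sets of vertices.\<close>
  have inj\<gamma>: "inj_on \<gamma> S"
  proof (rule inj_onI)
    fix v w assume "v \<in> S" "w \<in> S" "\<gamma> v = \<gamma> w"
    then have "{v} = {w}"
      by (intro inj_onD[OF inj]) (auto simp: \<gamma>_def)
    then show "v = w" by simp
  qed
  have sum\<gamma>: "(\<Sum>h\<in>\<gamma> ` A. h t) = (\<Sum>v\<in>A. ?g v t)" if "A \<subseteq> S" "t \<in> ?I" for A t
    unfolding sum.reindex[OF inj_on_subset[OF inj\<gamma> that(1)]] o_def \<gamma>_def restrict_apply'[OF that(2)] ..
  have I: "i < n \<Longrightarrow> Inl i \<in> ?I" "j \<le> Suc N \<Longrightarrow> Inr j \<in> ?I" for i j by auto
  have one: "?g v (Inr (Suc N)) = 1" for v by (simp add: slack_code_def)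
  show ?thesis
  proof (intro exI[of _ "\<gamma> ` S"] conjI)
    show "\<gamma> ` S \<subseteq> (?I \<rightarrow>\<^sub>E {- int P..int P})"
    proof (intro image_subsetI)
      fix v assume "v \<in> S"
      then have "\<bar>?g v t\<bar> \<le> int P" for t using rng S by blast
      then show "\<gamma> v \<in> (?I \<rightarrow>\<^sub>E {- int P..int P})"
        unfolding \<gamma>_def restrict_PiE_iff by (simp add: abs_le_iff minus_le_iff)
    qed
    show "card (\<gamma> ` S) \<le> k0" using cS card_image_le[OF fS] le_trans by blast
    show "decode n N (\<gamma> ` S) \<subseteq> {A. A \<subseteq> {..<n} \<and> sign_vector n A \<in> (\<lambda>x. (2 * \<rho> + 1) *\<^sub>R x) ` (convex hull V)}"
    proof
      fix X assume "X \<in> decode n N (\<gamma> ` S)"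
      then obtain C1 C2 where X: "X \<subseteq> {..<n}" and C: "C1 \<subseteq> \<gamma> ` S" "C2 \<subseteq> \<gamma> ` S"
        and x: "\<forall>i<n. (\<Sum>h\<in>C1. h (Inl i)) - (\<Sum>h\<in>C2. h (Inl i)) = (if i \<in> X then 1 else - 1)"
        and y: "\<forall>j\<le>N. 0 \<le> (\<Sum>h\<in>C1. h (Inr j)) - (\<Sum>h\<in>C2. h (Inr j))"
        and c: "(\<Sum>h\<in>C1. h (Inr (Suc N))) - (\<Sum>h\<in>C2. h (Inr (Suc N))) = 1"
        unfolding decode_def by blast
      obtain A A' where A: "A \<subseteq> S" "C1 = \<gamma> ` A" "A' \<subseteq> S" "C2 = \<gamma> ` A'"
        using C by (meson subset_imageE)
      note sums = sum\<gamma>[OF A(1)] sum\<gamma>[OF A(3)]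
      have "(\<Sum>v\<in>A. v) - (\<Sum>v\<in>A'. v) \<in> (\<lambda>x. (2 * \<rho> + 1) *\<^sub>R x) ` (convex hull V)"
      proof (rule slack_decode[OF q V \<rho> S cSP P(1) A(1,3)])
        show "0 \<le> (\<Sum>v\<in>A. ?g v (Inr j)) - (\<Sum>v\<in>A'. ?g v (Inr j))" if "j \<le> N" for j
          using y[rule_format, OF that] unfolding A(2,4) sums[OF I(2)[OF le_SucI[OF that]]] .
        show "int (card A) - int (card A') = 1"
          using c unfolding A(2,4) sums[OF I(2)[OF le_refl]] one by simp
      qed
      moreover have "(\<Sum>v\<in>A. v) - (\<Sum>v\<in>A'. v) = sign_vector n X"
      proof (rule poly_mapping_eqI)
        fix i
        have AV: "A \<subseteq> V" "A' \<subseteq> V" using A S by auto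
        show "lk ((\<Sum>v\<in>A. v) - (\<Sum>v\<in>A'. v)) i = lk (sign_vector n X) i"
        proof (cases "i < n")
          case True
          have e: "(\<Sum>v\<in>B. lk v i) = real_of_int (\<Sum>v\<in>B. ?g v (Inl i))" if "B \<subseteq> V" for B
            unfolding of_int_sum using lkf that by (intro sum.cong refl) (auto simp only: slack_code_def sum.case)
          have "(\<Sum>v\<in>A. ?g v (Inl i)) - (\<Sum>v\<in>A'. ?g v (Inl i)) = (if i \<in> X then 1 else - 1)"
            using x[rule_format, OF True] unfolding A(2,4) sums[OF I(1)[OF True]] .
          then have "real_of_int (\<Sum>v\<in>A. ?g v (Inl i)) - real_of_int (\<Sum>v\<in>A'. ?g v (Inl i)) = (if i \<in> X then 1 else - 1)"
            by (metis (full_types) of_int_1 of_int_diff of_int_minus)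
          then show ?thesis
            using True by (simp add: lookup_minus lookup_sum lookup_sign_vector e[OF AV(1)] e[OF AV(2)])
        next
          case False
          then have "(\<Sum>v\<in>A. lk v i) = 0" "(\<Sum>v\<in>A'. lk v i) = 0"
            using AV VR by (auto intro!: sum.neutral simp: Rn_iff subset_iff)
          then show ?thesis using False by (simp add: lookup_minus lookup_sum lookup_sign_vector)
        qed
      qed
      ultimately show "X \<in> {A. A \<subseteq> {..<n} \<and> sign_vector n A \<in> (\<lambda>x. (2 * \<rho> + 1) *\<^sub>R x) ` (convex hull V)}"
        using X by simp
    qed
    show "{A. A \<subseteq> {..<n} \<and> sign_vector n A \<in> V} \<subseteq> decode n N (\<gamma> ` S)"
    proof
      fix X assume "X \<in> {A. A \<subseteq> {..<n} \<and> sign_vector n A \<in> V}"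
      then have X: "X \<subseteq> {..<n}" and v: "sign_vector n X \<in> V" by auto
      let ?v = "sign_vector n X"
      obtain A A' where A: "A \<subseteq> S" "A' \<subseteq> S"
        and g: "\<forall>i\<in>?I. ?g ?v i = (\<Sum>w\<in>A. ?g w i) - (\<Sum>w\<in>A'. ?g w i)"
        using span[OF v] by blast
      have eq: "(\<Sum>h\<in>\<gamma> ` A. h t) - (\<Sum>h\<in>\<gamma> ` A'. h t) = ?g ?v t" if "t \<in> ?I" for t
        using g that A by (simp add: sum\<gamma>)
      have g0: "0 \<le> ?g ?v (Inr j)" if "j \<le> N" for j
      proof -
        have "0 \<le> q ?v j" using q v that by (simp add: slack_system_def)
        moreover have "q ?v j \<le> Max ((\<lambda>w. q w j) ` V)" using V v by simp
        ultimately show ?thesis using that by (simp add: slack_code_def)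
      qed
      have "\<gamma> ` A \<subseteq> \<gamma> ` S" "\<gamma> ` A' \<subseteq> \<gamma> ` S" using A by auto
      moreover have "\<forall>i<n. (\<Sum>h\<in>\<gamma> ` A. h (Inl i)) - (\<Sum>h\<in>\<gamma> ` A'. h (Inl i)) = (if i \<in> X then 1 else - 1)"
        using eq[OF I(1)] by (simp add: slack_code_def lookup_sign_vector floor_minus)
      moreover have "\<forall>j\<le>N. 0 \<le> (\<Sum>h\<in>\<gamma> ` A. h (Inr j)) - (\<Sum>h\<in>\<gamma> ` A'. h (Inr j))"
        using eq[OF I(2)] g0 by simp
      moreover have "(\<Sum>h\<in>\<gamma> ` A. h (Inr (Suc N))) - (\<Sum>h\<in>\<gamma> ` A'. h (Inr (Suc N))) = 1"
        using eq[OF I(2)[OF le_refl]] one by simp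
      ultimately show "X \<in> decode n N (\<gamma> ` S)"
        unfolding decode_def using X by blast
    qed
  qed
qed

section \<open>Existence of hard polytopes\<close>

text \<open>The vectors \<open>\<plusminus>e\<^sub>i\<close> give the hull nonempty interior for
  every choice of \<open>X\<close>, including \<open>M = 0\<close>.\<close>

definition vertices :: "nat \<Rightarrow> nat \<Rightarrow> (nat \<Rightarrow> nat set) \<Rightarrow> fvec set" where
  "vertices n M X = (\<lambda>j. sign_vector n (X j)) ` {..<M} \<union> (\<lambda>j. - sign_vector n (X j)) ` {..<M} \<union>
     (\<lambda>i. Poly_Mapping.single i 1) ` {..<n} \<union> (\<lambda>i. - Poly_Mapping.single i 1) ` {..<n}"

lemma finite_vertices: "finite (vertices n M X)"
  by (simp add: vertices_def)

lemma card_vertices_le: "card (vertices n M X) \<le> 2 * M + 2 * n"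
proof -
  have c: "card (f ` {..<m}) \<le> m" for f :: "nat \<Rightarrow> fvec" and m
    using card_image_le[of "{..<m}" f] by simp
  have u: "card (A \<union> B \<union> C \<union> D) \<le> card A + card B + card C + card D" for A B C D :: "fvec set"
    using card_Un_le[of "A \<union> B \<union> C" D] card_Un_le[of "A \<union> B" C] card_Un_le[of A B] by linarith
  show ?thesis unfolding vertices_def
    unfolding mult_2 add.assoc[symmetric] by (intro order_trans[OF u] add_mono c)
qed

lemma uminus_vertices: "uminus ` vertices n M X = vertices n M X"
  unfolding vertices_def image_Un image_image minus_minus by blast

lemma lookup_vertices: "v \<in> vertices n M X \<Longrightarrow> lk v i \<in> {-1, 0, 1}"
  unfolding vertices_def by (auto simp: lookup_sign_vector lookup_single_1 lookup_uminus split: if_splits)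

lemma single_in_Rn: "i < n \<Longrightarrow> Poly_Mapping.single i c \<in> Rn n"
  by (auto simp: Rn_iff lookup_single_1)

lemma vertices_subset_Rn: "vertices n M X \<subseteq> Rn n"
  unfolding vertices_def
  by (auto intro: sign_vector_in_Rn single_in_Rn subspace_neg[OF subspace_Rn])

lemma ip_vertices_le: "v \<in> vertices n M X \<Longrightarrow> ip v v \<le> real n"
proof -
  assume v: "v \<in> vertices n M X"
  then have "ip v v = (\<Sum>i<n. lk v i * lk v i)"
    using vertices_subset_Rn ip_Rn by blast
  also have "\<dots> \<le> (\<Sum>i<n. 1)"
  proof (rule sum_mono)
    show "lk v i * lk v i \<le> 1" for i using lookup_vertices[OF v, of i] by auto
  qed
  finally show ?thesis by simp
qed

section \<open>The hull as a convex body and lower bounds for its Banach-Mazur distance\<close>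

lemma norm_Rn: "x \<in> Rn n \<Longrightarrow> norm x = (\<Sum>i<n. \<bar>lk x i\<bar>)"
  unfolding norm_poly_mapping_def dist_poly_mapping_def
  by (auto simp: Rn_def in_keys_iff intro!: sum.mono_neutral_left)

text \<open>The norm is the l1 norm, whose unit ball is the cross-polytope: \<open>x\<close> is a
  convex combination of signed basis vectors, shrunk towards \<open>0\<close>.\<close>

lemma unit_ball_subset_hull:
  assumes n: "1 \<le> n" and V: "\<And>i. i < n \<Longrightarrow> Poly_Mapping.single i 1 \<in> V \<and> - Poly_Mapping.single i 1 \<in> V"
    and x: "x \<in> Rn n" "norm x \<le> 1"
  shows "x \<in> convex hull V"
proof -
  let ?e = "\<lambda>i. Poly_Mapping.single i (1::real)"
  have "(1/2) *\<^sub>R ?e 0 + (1/2) *\<^sub>R (- ?e 0) \<in> convex hull V"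
    using V[of 0] n by (intro convexD[OF convex_convex_hull]) (auto intro: hull_inc)
  then have 0: "0 \<in> convex hull V" by simp
  show ?thesis
  proof (cases "x = 0")
    case False
    let ?s = "\<lambda>i. if 0 \<le> lk x i then ?e i else - ?e i"
    have "(\<Sum>i<n. (\<bar>lk x i\<bar> / norm x) *\<^sub>R ?s i) \<in> convex hull V"
    proof (rule convex_sum)
      show "(\<Sum>i<n. \<bar>lk x i\<bar> / norm x) = 1"
        using False by (simp add: norm_Rn[OF x(1), symmetric] flip: sum_divide_distrib)
    qed (use V in \<open>auto intro: hull_inc\<close>)
    then have "norm x *\<^sub>R (\<Sum>i<n. (\<bar>lk x i\<bar> / norm x) *\<^sub>R ?s i) + (1 - norm x) *\<^sub>R 0 \<in> convex hull V"
      using 0 x(2) by (intro convexD[OF convex_convex_hull]) auto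
    also have "norm x *\<^sub>R (\<Sum>i<n. (\<bar>lk x i\<bar> / norm x) *\<^sub>R ?s i) + (1 - norm x) *\<^sub>R 0
        = (\<Sum>i<n. lk x i *\<^sub>R ?e i)"
      using False by (auto simp: scaleR_sum_right intro!: sum.cong)
    also have "\<dots> = x" using Rn_expansion[OF x(1)] by simp
    finally show ?thesis .
  qed (use 0 in simp)
qed

lemma single_in_vertices:
  "i < n \<Longrightarrow> Poly_Mapping.single i 1 \<in> vertices n M X \<and> - Poly_Mapping.single i 1 \<in> vertices n M X"
  unfolding vertices_def by blast

lemma convex_body_hull:
  assumes "1 \<le> n" "finite V" "V \<subseteq> Rn n"
    and "\<And>i. i < n \<Longrightarrow> Poly_Mapping.single i 1 \<in> V \<and> - Poly_Mapping.single i 1 \<in> V"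
  shows "convex_body n (convex hull V)"
  unfolding convex_body_def
proof (intro conjI)
  show "convex hull V \<subseteq> Rn n"
    using assms(3) subspace_imp_convex[OF subspace_Rn] by (rule hull_minimal)
  show "compact (convex hull V)" using assms(2) by (rule finite_imp_compact_convex_hull)
  have "openin (top_of_set (Rn n)) (Rn n \<inter> ball 0 1)" by (simp add: openin_open_Int)
  moreover have "Rn n \<inter> ball 0 1 \<subseteq> convex hull V"
    using unit_ball_subset_hull[OF assms(1,4)] by auto
  moreover have "0 \<in> Rn n \<inter> ball 0 1" by (simp add: subspace_0[OF subspace_Rn])
  ultimately show "top_of_set (Rn n) interior_of (convex hull V) \<noteq> {}"
    unfolding interior_of_def by blast
qed simp

text \<open>A lower bound for a real infimum requires a nonempty set. A homothety centred at an
  interior point of \<open>K\<close> provides an element.\<close>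

lemma banach_mazur_set_nonempty:
  assumes V: "finite V" "V \<subseteq> Rn n" and n: "1 \<le> n"
    and e: "\<And>i. i < n \<Longrightarrow> Poly_Mapping.single i 1 \<in> V \<and> - Poly_Mapping.single i 1 \<in> V"
    and K: "convex_body n K"
  shows "\<exists>l>0. \<exists>T a b. linear T \<and> bij_betw T (Rn n) (Rn n) \<and> a \<in> Rn n \<and> b \<in> Rn n \<and>
       (\<lambda>x. x - a) ` (convex hull V) \<subseteq> T ` (\<lambda>x. x - b) ` K \<and>
       T ` (\<lambda>x. x - b) ` K \<subseteq> (\<lambda>x. l *\<^sub>R x) ` (\<lambda>x. x - a) ` (convex hull V)"
proof -
  let ?B = "convex hull V"
  have KR: "K \<subseteq> Rn n" using K by (simp add: convex_body_def)
  have BR: "?B \<subseteq> Rn n" using convex_body_hull[OF n V e] by (simp add: convex_body_def)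
  have "bounded ?B" using V(1) by (simp add: finite_imp_compact_convex_hull compact_imp_bounded)
  then obtain R where R: "R > 0" "\<And>x. x \<in> ?B \<Longrightarrow> norm x \<le> R"
    using bounded_pos by blast
  have "bounded ((\<lambda>x. x - p) ` K)" for p
    using K by (intro bounded_translation_minus compact_imp_bounded) (simp add: convex_body_def)
  then have bd: "\<exists>r>0. \<forall>x\<in>K. norm (x - p) \<le> r" for p
    unfolding bounded_pos by auto
  obtain p U where U: "openin (top_of_set (Rn n)) U" "p \<in> U" "U \<subseteq> K"
    using K unfolding convex_body_def interior_of_def by blast
  then obtain \<epsilon> where \<epsilon>: "\<epsilon> > 0" "\<And>x. x \<in> Rn n \<Longrightarrow> dist x p < \<epsilon> \<Longrightarrow> x \<in> K"
    unfolding openin_euclidean_subtopology_iff by blast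
  obtain r where r: "r > 0" "\<And>x. x \<in> K \<Longrightarrow> norm (x - p) \<le> r" using bd[of p] by auto
  have pR: "p \<in> Rn n" using U KR by blast
  \<comment> \<open>The factor \<open>2\<close> gives \<open>R / t = \<epsilon> / 2\<close>, hence
    the strict inequality required by the open ball.\<close>
  define t where "t = 2 * R / \<epsilon>"
  define l where "l = t * r"
  have t: "t > 0" using R \<epsilon> by (simp add: t_def)
  have l: "l > 0" using t r by (simp add: l_def)
  note sub = subspace_Rn[of n]
  have "linear (scaleR t :: fvec \<Rightarrow> fvec)" by (rule linear_scaleR)
  moreover have "bij_betw (scaleR t) (Rn n) (Rn n)"
    using t by (intro bij_betwI[of _ _ _ "scaleR (1 / t)"]) (auto intro: subspace_scale[OF sub])
  moreover have "(\<lambda>x. x - 0) ` ?B \<subseteq> scaleR t ` (\<lambda>x. x - p) ` K"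
  proof
    fix y assume "y \<in> (\<lambda>x. x - 0) ` ?B"
    then have y: "y \<in> ?B" by simp
    have "norm y / t < \<epsilon>"
    proof -
      have "norm y / t \<le> R / t" using R(2)[OF y] t by (intro divide_right_mono) auto
      also have "\<dots> < \<epsilon>" using R \<epsilon> by (simp add: t_def)
      finally show ?thesis .
    qed
    then have "dist ((1 / t) *\<^sub>R y + p) p < \<epsilon>" using t by (simp add: dist_norm)
    moreover have "(1 / t) *\<^sub>R y + p \<in> Rn n"
      using y BR pR by (intro subspace_add[OF sub] subspace_scale[OF sub]) auto
    ultimately have "(1 / t) *\<^sub>R y + p \<in> K" using \<epsilon>(2) by blast
    then have "t *\<^sub>R ((1 / t) *\<^sub>R y + p - p) \<in> scaleR t ` (\<lambda>x. x - p) ` K" by blast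
    then show "y \<in> scaleR t ` (\<lambda>x. x - p) ` K" using t by simp
  qed
  moreover have "scaleR t ` (\<lambda>x. x - p) ` K \<subseteq> (\<lambda>x. l *\<^sub>R x) ` (\<lambda>x. x - 0) ` ?B"
  proof
    fix y assume "y \<in> scaleR t ` (\<lambda>x. x - p) ` K"
    then obtain x where x: "x \<in> K" "y = t *\<^sub>R (x - p)" by blast
    have "norm ((1 / r) *\<^sub>R (x - p)) \<le> 1" using r(2)[OF x(1)] r(1) by simp
    moreover have "(1 / r) *\<^sub>R (x - p) \<in> Rn n"
      using x KR pR by (intro subspace_diff[OF sub] subspace_scale[OF sub]) auto
    ultimately have "(1 / r) *\<^sub>R (x - p) \<in> ?B" by (intro unit_ball_subset_hull[OF n e])
    moreover have "y = l *\<^sub>R ((1 / r) *\<^sub>R (x - p) - 0)" using r(1) x(2) by (simp add: l_def)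
    ultimately show "y \<in> (\<lambda>x. l *\<^sub>R x) ` (\<lambda>x. x - 0) ` ?B" by blast
  qed
  moreover have "0 \<in> Rn n" by (rule subspace_0[OF sub])
  ultimately show ?thesis using l pR by blast
qed

text \<open>The factor \<open>2\<close> in front of \<open>\<tau>\<close> pays for the centre
  \<open>a\<close> in \<open>body_from_simplex_slack_system\<close>.\<close>

lemma banach_mazur_ge:
  assumes V: "finite V" "V \<subseteq> Rn n" "uminus ` V = V" and n: "1 \<le> n"
    and e: "\<And>i. i < n \<Longrightarrow> Poly_Mapping.single i 1 \<in> V \<and> - Poly_Mapping.single i 1 \<in> V"
    and K: "body_from_simplex n N K"
    and q: "\<And>\<rho> q. 0 < \<rho> \<Longrightarrow> slack_system N V \<rho> q \<Longrightarrow> 2 * \<tau> \<le> \<rho>"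
  shows "\<tau> \<le> banach_mazur n (convex hull V) K"
  unfolding banach_mazur_def
proof (rule cInf_greatest)
  have "convex_body n K" using K by (simp add: body_from_simplex_def)
  from banach_mazur_set_nonempty[OF V(1,2) n e this]
  show "{l. 0 < l \<and>
    (\<exists>T a b. linear T \<and> bij_betw T (Rn n) (Rn n) \<and> a \<in> Rn n \<and> b \<in> Rn n \<and>
       (\<lambda>x. x - a) ` (convex hull V) \<subseteq> T ` (\<lambda>x. x - b) ` K \<and>
       T ` (\<lambda>x. x - b) ` K \<subseteq> (\<lambda>x. l *\<^sub>R x) ` (\<lambda>x. x - a) ` (convex hull V))} \<noteq> {}"
    by blast
next
  fix l
  assume "l \<in> {l. 0 < l \<and>
    (\<exists>T a b. linear T \<and> bij_betw T (Rn n) (Rn n) \<and> a \<in> Rn n \<and> b \<in> Rn n \<and>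
       (\<lambda>x. x - a) ` (convex hull V) \<subseteq> T ` (\<lambda>x. x - b) ` K \<and>
       T ` (\<lambda>x. x - b) ` K \<subseteq> (\<lambda>x. l *\<^sub>R x) ` (\<lambda>x. x - a) ` (convex hull V))}"
  then obtain T a b where l: "0 < l" and T: "linear T"
    "(\<lambda>x. x - a) ` (convex hull V) \<subseteq> T ` (\<lambda>x. x - b) ` K"
    "T ` (\<lambda>x. x - b) ` K \<subseteq> (\<lambda>x. l *\<^sub>R x) ` (\<lambda>x. x - a) ` (convex hull V)"
    by blast
  have "V \<noteq> {}" using e[of 0] n by auto
  then obtain q' where "slack_system N V (2 * l) q'"
    using body_from_simplex_slack_system[OF K V(1) _ V(3) T] by blast
  then show "\<tau> \<le> l" using q[of "2 * l" q'] l by simp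
qed

text \<open>Unit mass at the basis vector \<open>?e\<close> is an admissible combination, so
  \<open>?e\<close> lies in the dilated hull, while coordinate \<open>0\<close> is at most
  \<open>1\<close> on the hull. This settles the range where the claimed bound is small.\<close>

lemma slack_system_ge_1:
  assumes "slack_system N (vertices n M X) \<rho> q" "1 \<le> n" "0 < \<rho>"
  shows "1 \<le> \<rho>"
proof -
  let ?V = "vertices n M X" and ?e = "Poly_Mapping.single 0 (1::real)"
  have e: "?e \<in> ?V" using single_in_vertices[of 0 n] assms(2) by simp
  have 1: "(\<Sum>v\<in>?V. of_bool (v = ?e) * f v) = f ?e" for f :: "fvec \<Rightarrow> real"
    using e finite_vertices by (simp add: of_bool_def if_distrib[of "\<lambda>t. t * _"] cong: if_cong)
  have 2: "(\<Sum>v\<in>?V. (of_bool (v = ?e) :: real) *\<^sub>R v) = ?e"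
    using e finite_vertices by (simp add: of_bool_def if_distrib[of "\<lambda>t. t *\<^sub>R _"] cong: if_cong)
  have "(\<Sum>v\<in>?V. (of_bool (v = ?e) :: real)) = 1" using 1[of "\<lambda>_. 1"] by simp
  moreover have "\<forall>j\<le>N. 0 \<le> (\<Sum>v\<in>?V. of_bool (v = ?e) * q v j)"
    unfolding 1 using assms(1) e by (simp add: slack_system_def)
  ultimately have "(\<Sum>v\<in>?V. (of_bool (v = ?e) :: real) *\<^sub>R v) \<in> (\<lambda>x. \<rho> *\<^sub>R x) ` (convex hull ?V)"
    using assms(1) unfolding slack_system_def by blast
  then have "?e \<in> (\<lambda>x. \<rho> *\<^sub>R x) ` (convex hull ?V)" unfolding 2 .
  then obtain z where z: "z \<in> convex hull ?V" "?e = \<rho> *\<^sub>R z" by blast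
  have "convex hull ?V \<subseteq> {x. lk x 0 \<le> 1}"
  proof (rule hull_minimal)
    show "?V \<subseteq> {x. lk x 0 \<le> 1}" using lookup_vertices[of _ n M X 0] by fastforce
    show "convex {x :: fvec. lk x 0 \<le> (1::real)}"
      unfolding convex_def by (auto simp: lookup_add convex_bound_le)
  qed
  then have "lk z 0 \<le> 1" using z(1) by blast
  moreover have "1 = \<rho> * lk z 0" using arg_cong[OF z(2), of "\<lambda>x. lk x 0"] by (simp add: lookup_single_1)
  ultimately show ?thesis using assms(3) by (metis mult.right_neutral mult_left_mono less_imp_le)
qed

text \<open>Otherwise each of the \<open>2 ^ (n * M)\<close> families \<open>X\<close> has a code
  decoding to at most \<open>2 powr (n / 2)\<close> sets, among them all \<open>X j\<close>. One
  code then covers at most \<open>(2 powr (n / 2)) ^ M\<close> families, and by the last assumption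
  there are too few codes.\<close>

lemma hard_vertices_exist:
  assumes n: "1 \<le> n" and \<tau>: "0 < \<tau>"
    and P: "0 < P" "k0 * (N + 1) \<le> P"
    and k0: "\<And>k. 2 ^ k \<le> (2 * P * k + 1) ^ (n + N + 2) \<Longrightarrow> k \<le> k0"
    and k: "1 \<le> k" "256 * (4 * \<tau> + 1)\<^sup>2 \<le> real k"
      "(exp 1 * real (2 * M + 2 * n + k) / real k) ^ k \<le> 2 powr (real n / 4)"
    and M: "(real ((2 * P + 1) ^ (n + N + 2) + 1)) ^ k0 * (2 powr (real n / 2)) ^ M < 2 ^ (n * M)"
  shows "\<exists>X. \<forall>\<rho> q. 0 < \<rho> \<longrightarrow> slack_system N (vertices n M X) \<rho> q \<longrightarrow> 2 * \<tau> \<le> \<rho>"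
proof (rule ccontr)
  assume contra: "\<not> ?thesis"
  let ?I = "{..<n} <+> {..Suc N} :: (nat + nat) set"
  let ?U = "?I \<rightarrow>\<^sub>E {- int P..int P}"
  define good where "good = {C. C \<subseteq> ?U \<and> card C \<le> k0 \<and> real (card (decode n N C)) \<le> 2 powr (real n / 2)}"
  have fU: "finite ?U" by (intro finite_PiE) auto
  have fgood: "finite good" unfolding good_def using fU by simp
  have "\<exists>C\<in>good. X \<in> {..<M} \<rightarrow>\<^sub>E decode n N C" if X: "X \<in> {..<M} \<rightarrow>\<^sub>E Pow {..<n}" for X
  proof -
    let ?V = "vertices n M X"
    obtain \<rho> q where \<rho>: "0 < \<rho>" "slack_system N ?V \<rho> q" "\<rho> < 2 * \<tau>"
      using contra by (meson not_le)
    have "\<exists>C. C \<subseteq> ?U \<and> card C \<le> k0 \<and>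
      decode n N C \<subseteq> {A. A \<subseteq> {..<n} \<and> sign_vector n A \<in> (\<lambda>x. (2 * \<rho> + 1) *\<^sub>R x) ` (convex hull ?V)} \<and>
      {A. A \<subseteq> {..<n} \<and> sign_vector n A \<in> ?V} \<subseteq> decode n N C"
      by (rule slack_code_exists[OF \<rho>(2) finite_vertices uminus_vertices less_imp_le[OF \<rho>(1)]
            vertices_subset_Rn _ P]) (rule lookup_vertices k0, assumption)+
    then obtain C where C: "C \<subseteq> ?U" "card C \<le> k0"
      "decode n N C \<subseteq> {A. A \<subseteq> {..<n} \<and> sign_vector n A \<in> (\<lambda>x. (2 * \<rho> + 1) *\<^sub>R x) ` (convex hull ?V)}"
      "{A. A \<subseteq> {..<n} \<and> sign_vector n A \<in> ?V} \<subseteq> decode n N C"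
      by blast
    have ne: "?V \<noteq> {}" using single_in_vertices[of 0 n M X] n by auto
    have "(2 * \<rho> + 1)\<^sup>2 \<le> (4 * \<tau> + 1)\<^sup>2" using \<rho> by (intro power_mono) auto
    then have k2: "256 * (2 * \<rho> + 1)\<^sup>2 \<le> real k" using k(2) by linarith
    have "card (decode n N C) \<le> card {A. A \<subseteq> {..<n} \<and> sign_vector n A \<in> (\<lambda>x. (2 * \<rho> + 1) *\<^sub>R x) ` (convex hull ?V)}"
      using C(3) by (intro card_mono) (auto intro: finite_subset[of _ "Pow {..<n}"])
    then have "real (card (decode n N C)) \<le> (exp 1 * (card ?V + k) / k) ^ k * 2 powr (3 * real n / 16)"
      using card_sign_vectors_in_hull_le[OF finite_vertices ne _ k(1) k2] ip_vertices_le[of _ n M X]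
      by (meson of_nat_le_iff order_trans)
    also have "\<dots> \<le> 2 powr (real n / 4) * 2 powr (3 * real n / 16)"
    proof (intro mult_right_mono)
      have "(exp 1 * (card ?V + k) / k) ^ k \<le> (exp 1 * real (2 * M + 2 * n + k) / real k) ^ k"
        using card_vertices_le[of n M X]
        by (intro power_mono divide_right_mono mult_left_mono) auto
      then show "(exp 1 * (card ?V + k) / k) ^ k \<le> 2 powr (real n / 4)" using k(3) by linarith
    qed simp
    \<comment> \<open>\<open>1 / 4 + 3 / 16 = 7 / 16\<close>, which is below
      \<open>1 / 2\<close>.\<close>
    also have "\<dots> \<le> 2 powr (real n / 2)"
      unfolding powr_add[symmetric] by (intro powr_mono) auto
    finally have "C \<in> good" using C by (simp add: good_def)
    moreover have "X j \<in> decode n N C" if "j < M" for j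
    proof -
      have "sign_vector n (X j) \<in> ?V" using that by (auto simp: vertices_def)
      then show ?thesis using C(4) X that by (auto simp: PiE_iff)
    qed
    then have "X \<in> {..<M} \<rightarrow>\<^sub>E decode n N C" using X by (auto simp: PiE_iff)
    ultimately show ?thesis by blast
  qed
  then have sub: "({..<M} \<rightarrow>\<^sub>E Pow {..<n}) \<subseteq> (\<Union>C\<in>good. {..<M} \<rightarrow>\<^sub>E decode n N C)"
    by (intro subsetI) (simp only: UN_iff)
  have fdec: "finite (decode n N C)" for C
    by (rule finite_subset[of _ "Pow {..<n}"]) (auto simp: decode_def)
  have "card ({..<M} \<rightarrow>\<^sub>E Pow {..<n}) \<le> card (\<Union>C\<in>good. {..<M} \<rightarrow>\<^sub>E decode n N C)"
    using sub fgood fdec by (intro card_mono finite_UN_I finite_PiE) auto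
  also have "\<dots> \<le> (\<Sum>C\<in>good. card ({..<M} \<rightarrow>\<^sub>E decode n N C))"
    using fgood by (rule card_UN_le)
  also have "\<dots> = (\<Sum>C\<in>good. card (decode n N C) ^ M)"
    by (simp add: card_PiE)
  finally have "2 ^ (n * M) \<le> (\<Sum>C\<in>good. card (decode n N C) ^ M)"
    by (simp add: card_PiE card_Pow power_mult)
  then have "real (2 ^ (n * M)) \<le> real (\<Sum>C\<in>good. card (decode n N C) ^ M)"
    by (simp only: of_nat_le_iff)
  also have "\<dots> = (\<Sum>C\<in>good. real (card (decode n N C)) ^ M)" by simp
  also have "\<dots> \<le> (\<Sum>C\<in>good. (2 powr (real n / 2)) ^ M)"
    by (intro sum_mono power_mono) (auto simp: good_def)
  also have "\<dots> = real (card good) * (2 powr (real n / 2)) ^ M" by simp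
  also have "\<dots> \<le> (real ((2 * P + 1) ^ (n + N + 2) + 1)) ^ k0 * (2 powr (real n / 2)) ^ M"
  proof (intro mult_right_mono)
    have "card good \<le> card {C. C \<subseteq> ?U \<and> card C \<le> k0}"
      unfolding good_def using fU by (intro card_mono) auto
    also have "\<dots> \<le> (card ?U + 1) ^ k0" using fU by (rule card_small_subsets_le)
    also have "card ?U = (2 * P + 1) ^ (n + N + 2)"
    proof -
      have "nat (1 + int P + int P) = 2 * P + 1" by simp
      then show ?thesis by (simp add: card_PiE card_Plus)
    qed
    finally have "real (card good) \<le> real (((2 * P + 1) ^ (n + N + 2) + 1) ^ k0)"
      by (simp only: of_nat_le_iff)
    then show "real (card good) \<le> (real ((2 * P + 1) ^ (n + N + 2) + 1)) ^ k0" by (simp only: of_nat_power)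
  qed simp
  finally show False using M by simp
qed

section \<open>Choice of parameters\<close>

text \<open>
  The precision \<open>(2 * N) ^ 12\<close> only has to exceed \<open>N + 1\<close> times the size of a dissociated set,
  which itself grows with the logarithm of the precision; any large power of \<open>N\<close> would do.
\<close>

lemma dissociated_size_bound:
  assumes "1 \<le> n" "n \<le> N" "2 ^ k \<le> (2 * (2 * N) ^ 12 * k + 1) ^ (n + N + 2)"
  shows "real k \<le> 180 * real N * ln (2 * real N)"
proof -
  define x P D where "x = 2 * real N" and "P = x ^ 12" and "D = real (n + N + 2)"
  have x: "2 \<le> x" using assms by (simp add: x_def)
  have D: "1 \<le> D" "D \<le> 4 * N" using assms by (auto simp: D_def)
  have P: "P \<ge> 1" using x by (simp add: P_def one_le_power)
  have lnx: "0 \<le> ln x" using x by simp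
  have "real (2 ^ k) \<le> real ((2 * (2 * N) ^ 12 * k + 1) ^ (n + N + 2))"
    using assms(3) by (simp only: of_nat_le_iff)
  then have "2 ^ k \<le> (2 * P * k + 1) ^ (n + N + 2)"
    by (simp only: P_def x_def of_nat_power of_nat_add of_nat_mult of_nat_numeral of_nat_1)
  moreover have pos: "0 < 2 * P * k + 1" using P by (intro add_nonneg_pos) auto
  ultimately have "ln (2 ^ k) \<le> ln ((2 * P * k + 1) ^ (n + N + 2))"
    by (subst ln_le_cancel_iff) (simp_all only: zero_less_power zero_less_numeral)
  then have "k * ln 2 \<le> D * ln (2 * P * k + 1)"
    unfolding D_def by (simp only: ln_realpow)
  also have "ln (2 * P * k + 1) \<le> ln ((x ^ 14) * (k + 1))"
  proof -
    have "x ^ 14 = x\<^sup>2 * P" by (simp add: P_def flip: power_add)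
    moreover have "4 * P \<le> x\<^sup>2 * P"
      using x P power_mono[of 2 x 2] by (intro mult_right_mono) auto
    ultimately have "2 * P + 1 \<le> x ^ 14" using P by linarith
    then have "(2 * P + 1) * (k + 1) \<le> x ^ 14 * (k + 1)" by (intro mult_right_mono) auto
    moreover have "2 * P * k + 1 \<le> (2 * P + 1) * (k + 1)" using P by (simp add: algebra_simps)
    ultimately have "2 * P * k + 1 \<le> x ^ 14 * (k + 1)" by linarith
    then show ?thesis using P x by (subst ln_le_cancel_iff) (auto intro!: add_nonneg_pos mult_pos_pos)
  qed
  also have "ln ((x ^ 14) * (k + 1)) = 14 * ln x + ln (1 + k)"
    using x by (simp add: ln_mult ln_realpow add.commute)
  \<comment> \<open>Tangent bound for the logarithm at \<open>4 * D\<close>: after multiplication by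
    \<open>D\<close>, the unknown \<open>k\<close> returns with coefficient \<open>1 / 4\<close>
    only and is absorbed on the left.\<close>
  also have "ln (1 + k) \<le> 4 * ln x + ((1 + k) / (4 * D) - 1)"
  proof -
    have "ln ((1 + k) / (4 * D)) \<le> (1 + k) / (4 * D) - 1"
      using D by (intro ln_le_minus_one) simp
    moreover have "ln ((1 + k) / (4 * D)) = ln (1 + k) - ln (4 * D)"
      using D by (simp add: ln_div)
    moreover have "ln (4 * D) \<le> 4 * ln x"
    proof -
      have "4 * D \<le> 2 ^ 3 * x" using D by (simp add: x_def)
      also have "\<dots> \<le> x ^ 3 * x" using x by (intro mult_right_mono power_mono) auto
      also have "\<dots> = x ^ 4" by (simp add: eval_nat_numeral)
      finally have "ln (4 * D) \<le> ln (x ^ 4)" using D x by (subst ln_le_cancel_iff) auto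
      then show ?thesis using x by (simp add: ln_realpow)
    qed
    ultimately show ?thesis by linarith
  qed
  finally have "k * ln 2 \<le> D * (14 * ln x + (4 * ln x + ((1 + k) / (4 * D) - 1)))"
    using D by (simp add: mult_left_mono)
  also have "\<dots> = 18 * (D * ln x) + (1 + k) / 4 - D" using D by (simp add: field_simps)
  also have "\<dots> \<le> 18 * (D * ln x) + k / 4"
    using D(1) unfolding of_nat_add of_nat_1 add_divide_distrib by linarith
  finally have 1: "k * ln 2 \<le> 18 * (D * ln x) + k / 4" .
  have "k * (2 / 3) \<le> k * ln 2" using ln2_ge_two_thirds by (intro mult_left_mono) auto
  moreover have "D * ln x \<le> 4 * N * ln x" using D lnx by (intro mult_right_mono) auto
  \<comment> \<open>\<open>2 / 3 - 1 / 4 = 5 / 12\<close>, and \<open>72 * 12 / 5\<close> is below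
    \<open>180\<close>.\<close>
  ultimately have "k * (5 / 12) \<le> 72 * (N * ln x)" using 1 by linarith
  moreover have "0 \<le> N * ln x" using lnx by simp
  ultimately show ?thesis unfolding x_def by (simp add: mult.assoc)
qed

lemma scaled_size_bound:
  assumes "1 \<le> N"
  shows "nat \<lfloor>180 * real N * ln (2 * real N)\<rfloor> * (N + 1) \<le> (2 * N) ^ 12"
proof -
  define x where "x = 2 * real N"
  have x: "2 \<le> x" using assms by (simp add: x_def)
  have lnx: "0 \<le> ln x" "ln x \<le> x" using x ln_le_minus_one[of x] by auto
  have "real (nat \<lfloor>180 * real N * ln x\<rfloor>) * real (N + 1) \<le> (90 * x * ln x) * x"
    using lnx assms x by (intro mult_mono) (auto simp: x_def)
  also have "\<dots> \<le> (90 * x * x) * x"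
    using lnx x by (intro mult_right_mono mult_left_mono) auto
  also have "\<dots> = 90 * x ^ 3" by (simp add: eval_nat_numeral)
  also have "\<dots> \<le> x ^ 9 * x ^ 3"
    using x power_mono[of 2 x 9] by (intro mult_right_mono) auto
  also have "\<dots> = real ((2 * N) ^ 12)" by (simp add: x_def flip: power_add)
  finally show ?thesis unfolding x_def by (simp only: of_nat_mult[symmetric] of_nat_le_iff)
qed

text \<open>With \<open>y = N * ln (2 * N)\<close> the codes number at most
  \<open>exp (56 * y)\<close> to the power \<open>180 * y\<close>, that is
  \<open>exp (10080 * y\<^sup>2)\<close>. The choice of \<open>M\<close> gives
  \<open>n * M \<ge> 40000 * y\<^sup>2\<close>, whose half times \<open>ln 2\<close> is
  larger.\<close>

lemma code_count_bound:
  assumes n: "1 \<le> n" "n \<le> N" and M: "40000 * (real N * ln (2 * real N))\<^sup>2 / real n \<le> real M"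
  shows "(real ((2 * (2 * N) ^ 12 + 1) ^ (n + N + 2) + 1)) ^ nat \<lfloor>180 * real N * ln (2 * real N)\<rfloor>
      * (2 powr (real n / 2)) ^ M < 2 ^ (n * M)"
proof -
  define x P where "x = 2 * real N" and "P = x ^ 12"
  define k0 where "k0 = nat \<lfloor>180 * real N * ln x\<rfloor>"
  define y where "y = real N * ln x"
  have x: "2 \<le> x" using n by (simp add: x_def)
  have P: "P \<ge> 1" using x by (simp add: P_def one_le_power)
  have "0 < ln x" using x by simp
  then have y: "y > 0" using n by (simp add: y_def)
  have "k0 = nat \<lfloor>180 * y\<rfloor>" by (simp only: k0_def y_def mult.assoc)
  then have k0: "real k0 \<le> 180 * y" using y by simp
  have "real ((2 * (2 * N) ^ 12 + 1) ^ (n + N + 2) + 1) = (2 * P + 1) ^ (n + N + 2) + 1"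
    by (simp only: P_def x_def of_nat_power of_nat_add of_nat_mult of_nat_numeral of_nat_1)
  \<comment> \<open>The summand \<open>1\<close>, which comes from padding small codes, is absorbed
    by enlarging the base.\<close>
  also have "\<dots> \<le> (2 * P + 2) ^ (n + N + 2)"
  proof -
    have "(2 * P + 1) ^ Suc m + 1 \<le> (2 * P + 2) ^ Suc m" for m
    proof -
      have "(2 * P + 1) ^ Suc m + 1 \<le> (2 * P + 1) * (2 * P + 2) ^ m + (2 * P + 2) ^ m"
        using P by (simp only: power_Suc) (intro add_mono mult_left_mono power_mono one_le_power; simp)
      then show ?thesis by (simp add: algebra_simps)
    qed
    from this[of "n + N + 1"] show ?thesis by simp
  qed
  also have "\<dots> \<le> (x ^ 14) ^ (n + N + 2)"
  proof (rule power_mono)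
    have "x ^ 14 = x\<^sup>2 * P" by (simp add: P_def flip: power_add)
    moreover have "4 * P \<le> x\<^sup>2 * P"
      using x P power_mono[of 2 x 2] by (intro mult_right_mono) auto
    ultimately show "2 * P + 2 \<le> x ^ 14" using P by linarith
  qed (use P in simp)
  also have "\<dots> \<le> (x ^ 14) ^ (4 * N)"
    using x n by (intro power_increasing) (auto simp: one_le_power)
  also have "\<dots> = x ^ (56 * N)" by (simp flip: power_mult)
  also have "\<dots> = exp (56 * y)"
  proof -
    have "exp (56 * y) = exp (real (56 * N) * ln x)" by (simp add: y_def)
    also have "\<dots> = exp (ln x) ^ (56 * N)" by (rule exp_of_nat_mult)
    finally show ?thesis using x by simp
  qed
  finally have "(real ((2 * (2 * N) ^ 12 + 1) ^ (n + N + 2) + 1)) ^ k0 \<le> exp (56 * y) ^ k0"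
    by (intro power_mono) auto
  also have "\<dots> = exp (k0 * (56 * y))" by (simp only: exp_of_nat_mult)
  also have "\<dots> \<le> exp (10080 * y\<^sup>2)"
  proof -
    have "k0 * (56 * y) \<le> (180 * y) * (56 * y)" using k0 y by (intro mult_right_mono) auto
    then show ?thesis by (simp add: power2_eq_square)
  qed
  also have "\<dots> < 2 powr (real n * real M / 2)"
  proof -
    have "40000 * y\<^sup>2 \<le> real n * real M" using M n by (simp add: y_def x_def field_simps)
    moreover have "real n * real M / 2 * (2 / 3) \<le> real n * real M / 2 * ln 2"
      using ln2_ge_two_thirds by (intro mult_left_mono) auto
    moreover have "0 < y\<^sup>2" using y by simp
    ultimately have "10080 * y\<^sup>2 < real n * real M / 2 * ln 2" by linarith
    then show ?thesis by (simp add: powr_def)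
  qed
  finally have "(real ((2 * (2 * N) ^ 12 + 1) ^ (n + N + 2) + 1)) ^ k0 * (2 powr (real n / 2)) ^ M
      < 2 powr (real n * real M / 2) * (2 powr (real n / 2)) ^ M"
    by (intro mult_strict_right_mono) auto
  also have "\<dots> = 2 powr (real n * real M)"
    by (simp add: powr_power mult.commute flip: powr_add)
  also have "\<dots> = 2 ^ (n * M)" by (simp add: powr_realpow flip: of_nat_mult)
  finally show ?thesis by (simp add: k0_def x_def)
qed

text \<open>Here the logarithm of the theorem enters: \<open>M\<close> is about
  \<open>10000 * n * exp (2 * L)\<close>, so the base is at most \<open>exp (28 + 3 * L)\<close>,
  and an exponent of order \<open>n / L\<close> keeps the power exponential in a small multiple of
  \<open>n\<close>.\<close>

lemma maurey_count_bound:
  assumes n: "1 \<le> n" "n \<le> N" and L: "L = ln (2 * real N * ln (2 * real N) / real n)" "1 / 4 \<le> L"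
    and big: "4000 * L \<le> real n"
  shows "(exp 1 * real (2 * nat \<lceil>40000 * (real N * ln (2 * real N))\<^sup>2 / real n\<rceil> + 2 * n + nat \<lfloor>real n / (2000 * L)\<rfloor>)
       / real (nat \<lfloor>real n / (2000 * L)\<rfloor>)) ^ nat \<lfloor>real n / (2000 * L)\<rfloor> \<le> 2 powr (real n / 4)"
proof -
  define M where "M = nat \<lceil>40000 * (real N * ln (2 * real N))\<^sup>2 / real n\<rceil>"
  define k where "k = nat \<lfloor>real n / (2000 * L)\<rfloor>"
  define E where "E = exp (2 * L)"
  have E: "1 \<le> E" using L(2) by (simp add: E_def)
  have lnN: "0 < ln (2 * real N)" using n by simp
  have "exp L = 2 * real N * ln (2 * real N) / real n"
    using n lnN by (simp add: L(1))
  then have e: "real N * ln (2 * real N) = real n * exp L / 2" using n by (simp add: field_simps)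
  have "40000 * (real N * ln (2 * real N))\<^sup>2 / real n = 10000 * real n * E"
    unfolding e using n by (simp add: E_def power2_eq_square field_simps flip: exp_add)
  then have "real M \<le> 10000 * real n * E + 1"
    using E unfolding M_def by simp
  moreover have nE: "real n \<le> real n * E" using E n by simp
  moreover have k_le: "real k \<le> real n / (2000 * L)"
    using L(2) by (simp add: k_def)
  moreover have "real n / (2000 * L) \<le> real n"
  proof -
    have "real n * 1 \<le> real n * (2000 * L)" using L(2) by (intro mult_left_mono) auto
    then show ?thesis using L(2) by (simp add: divide_le_eq)
  qed
  moreover have "1 \<le> real n" using n by simp
  \<comment> \<open>Multiples of \<open>n * E\<close>: \<open>20000 + 2\<close> from
    \<open>2 * M\<close>, \<open>2\<close> from \<open>2 * n\<close> and \<open>1\<close> from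
    \<open>k\<close>.\<close>
  ultimately have num: "real (2 * M + 2 * n + k) \<le> 20005 * (real n * E)"
    unfolding of_nat_add of_nat_mult of_nat_numeral by linarith
  have "2 \<le> real n / (2000 * L)" using big L(2) by (simp add: le_divide_eq)
  \<comment> \<open>Rounding down a number that is at least \<open>2\<close> loses at most half of
    it.\<close>
  then have kge: "real n / (4000 * L) \<le> real k"
    unfolding k_def by (simp add: field_simps) linarith
  have pos: "0 < real n / (4000 * L)" using n L(2) by simp
  have "exp 1 * real (2 * M + 2 * n + k) / real k \<le> 3 * (20005 * (real n * E)) / (real n / (4000 * L))"
    using num kge pos exp_le by (intro frac_le mult_mono) auto
  also have "\<dots> = 240060000 * L * E" using n L(2) by (simp add: field_simps)
  also have "\<dots> \<le> exp 28 * exp L * E"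
  proof (intro mult_mono)
    have "(2::real) ^ 28 \<le> exp 1 ^ 28" using exp_ge_add_one_self[of 1] by (intro power_mono) auto
    then show "240060000 \<le> exp (28::real)" by (simp add: exp_of_nat_mult[symmetric])
    show "L \<le> exp L" using exp_ge_add_one_self[of L] by linarith
  qed (use L(2) E in auto)
  also have "\<dots> = exp (28 + 3 * L)" by (simp add: E_def flip: exp_add)
  finally have "(exp 1 * real (2 * M + 2 * n + k) / real k) ^ k \<le> exp (28 + 3 * L) ^ k"
    by (intro power_mono) auto
  also have "\<dots> = exp (k * (28 + 3 * L))" by (simp only: exp_of_nat_mult)
  also have "\<dots> \<le> exp (real n / 6)"
  proof -
    have "k * (28 + 3 * L) \<le> real n / (2000 * L) * (28 + 3 * L)"
      using k_le L(2) by (intro mult_right_mono) auto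
    \<comment> \<open>\<open>28 \<le> 112 * L\<close> because \<open>L \<ge> 1 / 4\<close>.\<close>
    also have "\<dots> \<le> real n / (2000 * L) * (115 * L)"
      using L(2) by (intro mult_left_mono) auto
    also have "\<dots> \<le> real n / 6" using L(2) by simp
    finally show ?thesis by simp
  qed
  also have "\<dots> \<le> exp (real n / 4 * ln 2)"
  proof -
    have "real n / 4 * (2 / 3) \<le> real n / 4 * ln 2"
      using ln2_ge_two_thirds by (intro mult_left_mono) auto
    then show ?thesis by simp
  qed
  also have "\<dots> = 2 powr (real n / 4)" by (simp add: powr_def)
  finally show ?thesis unfolding M_def k_def .
qed

text \<open>Since \<open>n \<le> N\<close> and \<open>ln 2 \<ge> 2 / 3\<close>, the argument is at
  least \<open>4 / 3\<close>. The bound keeps the denominator in the theorem away from zero.\<close>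

lemma log_ratio_ge:
  assumes "1 \<le> n" "n \<le> N"
  shows "1 / 4 \<le> ln (2 * real N * ln (2 * real N) / real n)"
proof -
  have "ln 2 \<le> ln (2 * real N)" using assms by simp
  then have "2 / 3 \<le> ln (2 * real N)" using ln2_ge_two_thirds by linarith
  then have "(2 * real n) * (2 / 3) \<le> (2 * real N) * ln (2 * real N)"
    using assms by (intro mult_mono) auto
  then have "4 / 3 \<le> 2 * real N * ln (2 * real N) / real n"
    using assms by (simp add: field_simps)
  then have "ln (4 / 3) \<le> ln (2 * real N * ln (2 * real N) / real n)"
    by (subst ln_le_cancel_iff) auto
  moreover have "1 / 4 \<le> ln (4 / 3 :: real)"
    using ln_le_minus_one[of "3 / 4 :: real"] ln_div[of 3 "4 :: real"] ln_div[of 4 "3 :: real"] by simp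
  ultimately show ?thesis by linarith
qed

theorem theorem1p1:
  shows "\<exists>c::real. c > 0 \<and>
    (\<forall>n N :: nat. 1 \<le> n \<and> n \<le> N \<longrightarrow>
      (\<exists>B. convex_body n B \<and> symmetric B \<and>
        (\<forall>K. body_from_simplex n N K \<longrightarrow>
          banach_mazur n B K \<ge>
            c * sqrt (real n / ln (2 * real N * ln (2 * real N) / real n)))))"
proof (intro exI[of _ "1 / 10000"] conjI allI impI)
  fix n N :: nat
  assume nN: "1 \<le> n \<and> n \<le> N"
  then have n: "1 \<le> n" "n \<le> N" by auto
  define L where "L = ln (2 * real N * ln (2 * real N) / real n)"
  define \<tau> where "\<tau> = 1 / 10000 * sqrt (real n / L)"
  have L: "1 / 4 \<le> L" using log_ratio_ge[OF n] by (simp add: L_def)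
  have \<tau>: "0 < \<tau>" using n L by (simp add: \<tau>_def)
  have "\<exists>M X. \<forall>\<rho> q. 0 < \<rho> \<longrightarrow> slack_system N (vertices n M X) \<rho> q \<longrightarrow> 2 * \<tau> \<le> \<rho>"
  \<comment> \<open>For small \<open>\<tau>\<close> the trivial bound \<open>\<rho> \<ge> 1\<close>
    suffices, with no sign vectors at all. Otherwise \<open>n / L\<close> is at least
    \<open>25000000\<close>, which makes \<open>k\<close> large.\<close>
  proof (cases "\<tau> \<le> 1 / 2")
    case True
    then have "2 * \<tau> \<le> \<rho>" if "0 < \<rho>" "slack_system N (vertices n 0 (\<lambda>_. {})) \<rho> q" for \<rho> q
      using slack_system_ge_1[OF that(2) n(1) that(1)] by linarith
    then show ?thesis by blast
  next
    case False
    define w k where "w = real n / L" and "k = nat \<lfloor>real n / (2000 * L)\<rfloor>"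
    have \<tau>2: "\<tau>\<^sup>2 = w / 100000000"
      using n L by (simp add: \<tau>_def w_def power_mult_distrib power_divide)
    have "(1 / 2)\<^sup>2 \<le> \<tau>\<^sup>2" using False by (intro power_mono) auto
    then have w: "25000000 \<le> w" unfolding \<tau>2 by (simp add: power2_eq_square)
    then have big: "4000 * L \<le> real n" using L by (simp add: w_def le_divide_eq)
    have "y - 1 \<le> real (nat \<lfloor>y\<rfloor>)" for y :: real by linarith
    from this[of "real n / (2000 * L)"] have "w / 2000 - 1 \<le> real k"
      by (simp add: w_def k_def)
    then have k: "w / 4000 \<le> real k" using w by linarith
    \<comment> \<open>As \<open>\<tau>\<close> exceeds \<open>1 / 2\<close>,
      \<open>1 \<le> 2 * \<tau>\<close>; moreover \<open>9216 = 256 * 36\<close>, and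
      \<open>9216 / 100000000\<close> is below \<open>1 / 4000\<close>.\<close>
    have "(4 * \<tau> + 1)\<^sup>2 \<le> (6 * \<tau>)\<^sup>2" using False by (intro power_mono) auto
    then have "256 * (4 * \<tau> + 1)\<^sup>2 \<le> 9216 * \<tau>\<^sup>2" by (simp add: power_mult_distrib)
    then have k2: "256 * (4 * \<tau> + 1)\<^sup>2 \<le> real k" using k w unfolding \<tau>2 by linarith
    have "1 \<le> real k" using k w by linarith
    then have k1: "1 \<le> k" by linarith
    have "\<exists>X. \<forall>\<rho> q. 0 < \<rho> \<longrightarrow> slack_system N (vertices n (nat \<lceil>40000 * (real N * ln (2 * real N))\<^sup>2 / real n\<rceil>) X) \<rho> q \<longrightarrow> 2 * \<tau> \<le> \<rho>"
    proof (rule hard_vertices_exist[OF n(1) \<tau> _ scaled_size_bound _ k1 k2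
          maurey_count_bound[OF n L_def L big, folded k_def] code_count_bound[OF n]])
      show "0 < (2 * N) ^ 12" "1 \<le> N" using n by auto
      show "k \<le> nat \<lfloor>180 * real N * ln (2 * real N)\<rfloor>"
        if "2 ^ k \<le> (2 * (2 * N) ^ 12 * k + 1) ^ (n + N + 2)" for k
        using dissociated_size_bound[OF n that] by linarith
    qed (rule of_nat_ceiling)
    then show ?thesis by blast
  qed
  then obtain M X where *: "\<And>\<rho> q. 0 < \<rho> \<Longrightarrow> slack_system N (vertices n M X) \<rho> q \<Longrightarrow> 2 * \<tau> \<le> \<rho>"
    by blast
  let ?V = "vertices n M X"
  show "\<exists>B. convex_body n B \<and> symmetric B \<and> (\<forall>K. body_from_simplex n N K \<longrightarrow>
      1 / 10000 * sqrt (real n / ln (2 * real N * ln (2 * real N) / real n)) \<le> banach_mazur n B K)"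
  proof (intro exI[of _ "convex hull ?V"] conjI allI impI)
    show "convex_body n (convex hull ?V)"
      by (rule convex_body_hull[OF n(1) finite_vertices vertices_subset_Rn single_in_vertices])
    show "symmetric (convex hull ?V)"
      unfolding symmetric_def convex_hull_linear_image[OF linear_uminus] uminus_vertices ..
    fix K assume K: "body_from_simplex n N K"
    show "1 / 10000 * sqrt (real n / ln (2 * real N * ln (2 * real N) / real n)) \<le> banach_mazur n (convex hull ?V) K"
      unfolding L_def[symmetric] \<tau>_def[symmetric]
      by (rule banach_mazur_ge[OF finite_vertices vertices_subset_Rn uminus_vertices n(1) single_in_vertices K *])
  qed
qed simp

end
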